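(* For all $n\ge 1$ and $k,\ell,m,j\ge0$, let $$g_n(k,\ell,m,j)=\bigl|\{\pi\in\mathcal{S}_n(321,4123) : \operatorname{cyc}(\pi)=k,\ \operatorname{exc}(\pi)=\ell,\ \operatorname{fp}(\pi)=m,\ \operatorname{inv}(\pi)=j\}\bigr|,$$ and let $$G(t,u,x,y,z)=\sum_{n\ge1}\ \sum_{k,\ell,m,j\ge0} g_n(k,\ell,m,j)\,t^ku^mx^\ell y^jz^n,$$ a formal power series in $z$ with coefficients in $\mathbb{Z}[t,u,x,y]$. Then $$G(t,u,x,y,z)=\frac{tz\bigl(u+xyz(1-u)+xy^2z^2(1-uxy^2-u)+x^2y^4z^3(xy-t)(u-1)\bigr)}{1-z(xy+tu)+z^2\mathfrak{g}_2(t,u,x,y)+z^3\mathfrak{g}_3(t,u,x,y)+z^4\mathfrak{g}_4(t,u,x,y)},$$ where $$\mathfrak{g}_2(t,u,x,y)=xy\bigl(t(u-1)-y-xy^3\bigr),$$ $$\mathfrak{g}_3(t,u,x,y)=xy^2\bigl(ut-t+xy^2(ut+xy-t)\bigr),$$ $$\mathfrak{g}_4(t,u,x,y)=tx^2y^4(xy-t)(1-u).$$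
   Context: $\mathcal{S}_n$ is the set of permutations of $[n]=\{1,\dots,n\}$; $\pi\in\mathcal{S}_n$ is written in one-line notation as $\pi=\pi_1\pi_2\cdots\pi_n$ with $\pi_i=\pi(i)$. A permutation $\pi\in\mathcal{S}_n$ contains a pattern $\sigma\in\mathcal{S}_r$ if there are indices $i_1<\dots<i_r$ such that $\pi_{i_1}\cdots\pi_{i_r}$ is in the same relative order as $\sigma$; otherwise $\pi$ avoids $\sigma$. $\mathcal{S}_n(321,4123)$ is the set of $\pi\in\mathcal{S}_n$ avoiding both patterns $321$ and $4123$. $\operatorname{cyc}(\pi)$ is the number of cycles in the disjoint cycle decomposition of $\pi$ (fixed points counted as cycles); $\operatorname{fp}(\pi)$ is the number of $i$ with $\pi_i=i$; $\operatorname{exc}(\pi)$ is the number of $j$ with $\pi_j>j$; $\operatorname{inv}(\pi)$ is the number of pairs $i<j$ with $\pi_i>\pi_j$. *)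

theory Defs
  imports
    "HOL-Combinatorics.Permutations"
    "HOL-Combinatorics.Orbits"
    "HOL-Computational_Algebra.Polynomial"
    "HOL-Computational_Algebra.Formal_Power_Series"
    "HOL-Library.Groups_Big_Fun"
begin

text \<open>A permutation of \<open>[n]\<close> is a function \<open>p\<close> with \<open>p permutes {1..n}\<close>. A pattern is
  given by its one-line notation as a list, so its positions are numbered from \<open>0\<close>.\<close>

definition contains_pattern :: "nat \<Rightarrow> (nat \<Rightarrow> nat) \<Rightarrow> nat list \<Rightarrow> bool" where
  "contains_pattern n p \<sigma> \<longleftrightarrow>
     (\<exists>i :: nat \<Rightarrow> nat.
        strict_mono_on {..<length \<sigma>} i \<and> i ` {..<length \<sigma>} \<subseteq> {1..n} \<and>
        (\<forall>a<length \<sigma>. \<forall>b<length \<sigma>. p (i a) < p (i b) \<longleftrightarrow> \<sigma> ! a < \<sigma> ! b))"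

definition avoids :: "nat \<Rightarrow> (nat \<Rightarrow> nat) \<Rightarrow> nat list \<Rightarrow> bool" where
  "avoids n p \<sigma> \<longleftrightarrow> \<not> contains_pattern n p \<sigma>"

definition S_avoiding :: "nat \<Rightarrow> nat list set \<Rightarrow> (nat \<Rightarrow> nat) set" where
  "S_avoiding n \<Sigma> = {p. p permutes {1..n} \<and> (\<forall>\<sigma>\<in>\<Sigma>. avoids n p \<sigma>)}"

text \<open>The cycles of a permutation are identified with their underlying sets, the orbits;
  the orbit of a fixed point is a singleton, so fixed points are counted.\<close>

definition cyc :: "nat \<Rightarrow> (nat \<Rightarrow> nat) \<Rightarrow> nat" where
  "cyc n p = card {orbit p i | i. i \<in> {1..n}}"

definition exc :: "nat \<Rightarrow> (nat \<Rightarrow> nat) \<Rightarrow> nat" where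
  "exc n p = card {j \<in> {1..n}. p j > j}"

definition fp :: "nat \<Rightarrow> (nat \<Rightarrow> nat) \<Rightarrow> nat" where
  "fp n p = card {i \<in> {1..n}. p i = i}"

definition inv_count :: "nat \<Rightarrow> (nat \<Rightarrow> nat) \<Rightarrow> nat" where
  "inv_count n p = card {(i, j). i \<in> {1..n} \<and> j \<in> {1..n} \<and> i < j \<and> p i > p j}"

definition gnum :: "nat \<Rightarrow> nat \<Rightarrow> nat \<Rightarrow> nat \<Rightarrow> nat \<Rightarrow> nat" where
  "gnum n k l m j =
     card {p \<in> S_avoiding n {[3, 2, 1], [4, 1, 2, 3]}.
             cyc n p = k \<and> exc n p = l \<and> fp n p = m \<and> inv_count n p = j}"

text \<open>The polynomial ring \<open>\<int>[t, u, x, y]\<close>, realised as \<open>\<int>[y][x][u][t]\<close>.\<close>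

type_synonym poly4 = "int poly poly poly poly"

definition var_t :: poly4 where "var_t = [:0, 1:]"
definition var_u :: poly4 where "var_u = [:[:0, 1:]:]"
definition var_x :: poly4 where "var_x = [:[:[:0, 1:]:]:]"
definition var_y :: poly4 where "var_y = [:[:[:[:0, 1:]:]:]:]"

text \<open>\<^const>\<open>Sum_any\<close> is the sum over all tuples; it is \<open>0\<close> by convention if
  infinitely many summands are nonzero, which \<open>finite_support_gnum\<close> below excludes.\<close>

definition Gfun :: "poly4 fps" where
  "Gfun = Abs_fps (\<lambda>n. if n \<ge> 1 then
         Sum_any (\<lambda>(k, l, m, j).
           of_nat (gnum n k l m j) * var_t ^ k * var_u ^ m * var_x ^ l * var_y ^ j)
       else 0)"

lemma finite_support_gnum: "finite {(k, l, m, j). gnum n k l m j \<noteq> 0}"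
proof (rule finite_subset)
  let ?f = "\<lambda>p. (cyc n p, exc n p, fp n p, inv_count n p)"
  let ?S = "S_avoiding n {[3, 2, 1], [4, 1, 2, 3]}"
  show "{(k, l, m, j). gnum n k l m j \<noteq> 0} \<subseteq> ?f ` ?S"
  proof
    fix v
    assume "v \<in> {(k, l, m, j). gnum n k l m j \<noteq> 0}"
    then obtain k l m j where v: "v = (k, l, m, j)" and "gnum n k l m j \<noteq> 0"
      by auto
    then have "{p \<in> ?S. cyc n p = k \<and> exc n p = l \<and> fp n p = m \<and> inv_count n p = j} \<noteq> {}"
      unfolding gnum_def by (metis card.empty)
    then show "v \<in> ?f ` ?S"
      unfolding v by blast
  qed
  have "finite {p. p permutes {1..n}}"
    by (rule finite_permutations) simp
  moreover have "?S \<subseteq> {p. p permutes {1..n}}"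
    unfolding S_avoiding_def by blast
  ultimately have "finite ?S"
    by (rule rev_finite_subset)
  then show "finite (?f ` ?S)"
    by (rule finite_imageI)
qed

text \<open>Library division of power series needs a coefficient type of class \<open>inverse\<close>, which
  \<^typ>\<open>poly4\<close> is not. This is the quotient for a denominator with constant term \<open>1\<close>.\<close>

definition fps_quot :: "'a::comm_ring_1 fps \<Rightarrow> 'a fps \<Rightarrow> 'a fps" where
  "fps_quot N D = N * fps_right_inverse D 1"

lemma fps_quot_iff:
  fixes N D F :: "'a::comm_ring_1 fps"
  assumes "fps_nth D 0 = 1"
  shows "F = fps_quot N D \<longleftrightarrow> F * D = N"
proof -
  have inv: "D * fps_right_inverse D 1 = 1"
    using assms by (intro fps_right_inverse) simp
  show ?thesis
  proof
    assume "F = fps_quot N D"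
    then have "F * D = N * (D * fps_right_inverse D 1)"
      by (simp only: fps_quot_def mult_ac)
    then show "F * D = N"
      by (simp only: inv mult_1_right)
  next
    assume "F * D = N"
    then have "fps_quot N D = F * (D * fps_right_inverse D 1)"
      by (simp only: fps_quot_def mult.assoc flip: \<open>F * D = N\<close>)
    then show "F = fps_quot N D"
      by (simp only: inv mult_1_right)
  qed
qed

definition \<gg>\<^sub>2 :: "'a::comm_ring_1 \<Rightarrow> 'a \<Rightarrow> 'a \<Rightarrow> 'a \<Rightarrow> 'a" where
  "\<gg>\<^sub>2 t u x y = x * y * (t * (u - 1) - y - x * y ^ 3)"

definition \<gg>\<^sub>3 :: "'a::comm_ring_1 \<Rightarrow> 'a \<Rightarrow> 'a \<Rightarrow> 'a \<Rightarrow> 'a" where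
  "\<gg>\<^sub>3 t u x y = x * y ^ 2 * (u * t - t + x * y ^ 2 * (u * t + x * y - t))"

definition \<gg>\<^sub>4 :: "'a::comm_ring_1 \<Rightarrow> 'a \<Rightarrow> 'a \<Rightarrow> 'a \<Rightarrow> 'a" where
  "\<gg>\<^sub>4 t u x y = t * x ^ 2 * y ^ 4 * (x * y - t) * (1 - u)"

end

theory Submission
  imports Defs
begin

text \<open>
  In a permutation avoiding 321 and 4123 the letters after the maximum are increasing and there
  are at most two of them, so \<open>n\<close> sits in one of the last three positions. If it is last, it is a
  fixed point; if it is last but one, the permutation is \<open>q \<circ> (n-1 n)\<close> for an avoider \<open>q\<close> of length
  \<open>n - 1\<close>. If it is last but two, then either \<open>n - 1\<close> is the final letter, or the same argument puts
  \<open>n - 1\<close> directly before \<open>n\<close>; correspondingly the permutation is \<open>q \<circ> (n-2 n-1) \<circ> (n-2 n)\<close> or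
  \<open>q \<circ> (n-3 n-1) \<circ> (n-2 n)\<close> for an avoider \<open>q\<close> of length \<open>n - 2\<close>, which in the second case must end
  with an ascent. Multiplying by \<open>(i n)\<close> inserts \<open>n\<close> into the cycle of \<open>i\<close>, which keeps the number of
  cycles and makes the effect on the other statistics explicit. This gives a linear system for the
  generating functions, from which the formula follows by elimination.
\<close>

section \<open>Avoidance in terms of positions\<close>

text \<open>Containment unfolded into explicit positions. The function is arbitrary because the
  property is also applied to words such as \<open>delete_at q p\<close>, which as functions are not
  permutations of an initial segment.\<close>

definition avoiding :: "nat \<Rightarrow> (nat \<Rightarrow> nat) \<Rightarrow> bool" where
  "avoiding n p \<longleftrightarrow>
     \<not> (\<exists>i j k. 1 \<le> i \<and> i < j \<and> j < k \<and> k \<le> n \<and> p k < p j \<and> p j < p i) \<and>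
     \<not> (\<exists>i j k l. 1 \<le> i \<and> i < j \<and> j < k \<and> k < l \<and> l \<le> n \<and>
           p j < p k \<and> p k < p l \<and> p l < p i)"

lemma contains_321_iff:
  "contains_pattern n p [3, 2, 1] \<longleftrightarrow>
     (\<exists>i j k. 1 \<le> i \<and> i < j \<and> j < k \<and> k \<le> n \<and> p k < p j \<and> p j < p i)"
proof
  assume "contains_pattern n p [3, 2, 1]"
  then obtain f where f: "strict_mono_on {..<length [3::nat, 2, 1]} f"
     "f ` {..<length [3::nat, 2, 1]} \<subseteq> {1..n}"
     and *: "\<And>a b. a < length [3::nat, 2, 1] \<Longrightarrow> b < length [3::nat, 2, 1] \<Longrightarrow>
         p (f a) < p (f b) \<longleftrightarrow> [3::nat, 2, 1] ! a < [3, 2, 1] ! b"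
    unfolding contains_pattern_def by blast
  have "1 \<le> f 0" "f 0 < f 1" "f 1 < f 2" "f 2 \<le> n"
    using f by (auto simp: strict_mono_on_def image_subset_iff)
  moreover have "p (f 2) < p (f 1)" "p (f 1) < p (f 0)"
    using *[of 2 1] *[of 1 0] by simp_all
  ultimately show "\<exists>i j k. 1 \<le> i \<and> i < j \<and> j < k \<and> k \<le> n \<and> p k < p j \<and> p j < p i" by blast
next
  assume "\<exists>i j k. 1 \<le> i \<and> i < j \<and> j < k \<and> k \<le> n \<and> p k < p j \<and> p j < p i"
  then obtain i j k where "1 \<le> i" "i < j" "j < k" "k \<le> n" "p k < p j" "p j < p i" by blast
  then show "contains_pattern n p [3, 2, 1]"
    unfolding contains_pattern_def
    by (intro exI[of _ "\<lambda>a. [i, j, k] ! a"])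
       (auto simp: strict_mono_on_def less_Suc_eq)
qed

lemma contains_4123_iff:
  "contains_pattern n p [4, 1, 2, 3] \<longleftrightarrow>
     (\<exists>i j k l. 1 \<le> i \<and> i < j \<and> j < k \<and> k < l \<and> l \<le> n \<and> p j < p k \<and> p k < p l \<and> p l < p i)"
proof
  let ?s = "[4, 1, 2, 3] :: nat list"
  assume "contains_pattern n p [4, 1, 2, 3]"
  then obtain f where f: "strict_mono_on {..<length ?s} f" "f ` {..<length ?s} \<subseteq> {1..n}"
     and *: "\<And>a b. a < length ?s \<Longrightarrow> b < length ?s \<Longrightarrow> p (f a) < p (f b) \<longleftrightarrow> ?s ! a < ?s ! b"
    unfolding contains_pattern_def by blast
  have "1 \<le> f 0" "f 0 < f 1" "f 1 < f 2" "f 2 < f 3" "f 3 \<le> n"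
    using f by (auto simp: strict_mono_on_def image_subset_iff)
  moreover have "p (f 1) < p (f 2)" "p (f 2) < p (f 3)" "p (f 3) < p (f 0)"
    using *[of 1 2] *[of 2 3] *[of 3 0] by simp_all
  ultimately show "\<exists>i j k l. 1 \<le> i \<and> i < j \<and> j < k \<and> k < l \<and> l \<le> n \<and>
      p j < p k \<and> p k < p l \<and> p l < p i" by blast
next
  assume "\<exists>i j k l. 1 \<le> i \<and> i < j \<and> j < k \<and> k < l \<and> l \<le> n \<and> p j < p k \<and> p k < p l \<and> p l < p i"
  then obtain i j k l where "1 \<le> i" "i < j" "j < k" "k < l" "l \<le> n" "p j < p k" "p k < p l" "p l < p i"
    by blast
  then show "contains_pattern n p [4, 1, 2, 3]"
    unfolding contains_pattern_def
    by (intro exI[of _ "\<lambda>a. [i, j, k, l] ! a"])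
       (auto simp: strict_mono_on_def less_Suc_eq)
qed

definition avoiders :: "nat \<Rightarrow> (nat \<Rightarrow> nat) set" where
  "avoiders n = S_avoiding n {[3, 2, 1], [4, 1, 2, 3]}"

lemma mem_avoiders_iff: "p \<in> avoiders n \<longleftrightarrow> p permutes {1..n} \<and> avoiding n p"
  unfolding avoiders_def S_avoiding_def avoids_def avoiding_def
    contains_321_iff[symmetric] contains_4123_iff[symmetric]
  by simp

section \<open>Deleting the largest letter of a word\<close>

definition delete_at :: "nat \<Rightarrow> (nat \<Rightarrow> nat) \<Rightarrow> nat \<Rightarrow> nat" where
  "delete_at q p j = (if j < q then p j else p (Suc j))"

text \<open>Deleting a letter creates no pattern. Conversely, an occurrence through \<open>q\<close>
  must use the maximum as its 3 or its 4, hence as its first letter; at most two letters follow it,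
  too few for 4123, and if there are two then \<open>asc\<close> rules out 321. Values need no
  renumbering, since the deleted letter is the largest.\<close>

lemma avoiding_delete_at_iff:
  assumes q: "1 \<le> q" "q \<le> Suc m" "m \<le> Suc q"
    and max: "\<And>j. 1 \<le> j \<Longrightarrow> j \<le> Suc m \<Longrightarrow> j \<noteq> q \<Longrightarrow> p j < p q"
    and asc: "m = Suc q \<Longrightarrow> p (Suc q) < p (Suc (Suc q))"
  shows "avoiding (Suc m) p \<longleftrightarrow> avoiding m (delete_at q p)"
proof
  \<comment> \<open>\<open>s\<close> embeds the positions of the shortened word into the old ones,
    skipping \<open>q\<close>.\<close>
  define s where "s j = (if j < q then j else Suc j)" for j
  have del: "delete_at q p j = p (s j)" for j by (simp add: delete_at_def s_def)
  assume av: "avoiding (Suc m) p"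
  show "avoiding m (delete_at q p)"
    unfolding avoiding_def del
  proof (intro conjI notI; elim exE conjE)
    fix i j k assume *: "1 \<le> i" "i < j" "j < k" "k \<le> m" "p (s k) < p (s j)" "p (s j) < p (s i)"
    then have "1 \<le> s i" "s i < s j" "s j < s k" "s k \<le> Suc m"
      by (auto simp: s_def)
    with * av show False
      unfolding avoiding_def by blast
  next
    fix i j k l assume *: "1 \<le> i" "i < j" "j < k" "k < l" "l \<le> m"
      "p (s j) < p (s k)" "p (s k) < p (s l)" "p (s l) < p (s i)"
    then have "1 \<le> s i" "s i < s j" "s j < s k" "s k < s l" "s l \<le> Suc m"
      by (auto simp: s_def)
    with * av show False
      unfolding avoiding_def by blast
  qed
next
  \<comment> \<open>\<open>r\<close> goes back: it closes the gap at \<open>q\<close> and is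
    increasing away from \<open>q\<close>.\<close>
  define r where "r j = (if j < q then j else j - 1)" for j
  have r: "delete_at q p (r j) = p j" "1 \<le> r j" "r j \<le> m" if "1 \<le> j" "j \<le> Suc m" "j \<noteq> q" for j
    using that q by (auto simp: delete_at_def r_def)
  have r_less: "r i < r j" if "i < j" "i \<noteq> q" "j \<noteq> q" for i j
    using that by (auto simp: r_def)
  assume av: "avoiding m (delete_at q p)"
  have 1: "\<not> p j < p i" if ijk: "1 \<le> i" "i < j" "j < k" "k \<le> Suc m" "p k < p j" for i j k :: nat
  proof
    assume lt: "p j < p i"
    have "j \<noteq> q" using max[of i] ijk lt by auto
    moreover have "k \<noteq> q" using max[of j] ijk by auto
    moreover have "i \<noteq> q"
    proof
      assume "i = q"
      then have "m = Suc q" "j = Suc q" "k = Suc (Suc q)" using ijk q by auto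
      then show False using asc ijk by (metis less_asym)
    qed
    ultimately have "1 \<le> r i" "r i < r j" "r j < r k" "r k \<le> m"
      "delete_at q p (r k) < delete_at q p (r j)" "delete_at q p (r j) < delete_at q p (r i)"
      using r[of i] r[of j] r[of k] r_less[of i j] r_less[of j k] ijk lt by simp_all
    then show False
      using av unfolding avoiding_def by blast
  qed
  have 2: "\<not> p l < p i" if ijk: "1 \<le> i" "i < j" "j < k" "k < l" "l \<le> Suc m" "p j < p k" "p k < p l" for i j k l
  proof
    assume lt: "p l < p i"
    have "j \<noteq> q" "k \<noteq> q" "l \<noteq> q" using max[of i] max[of k] max[of l] ijk lt
      by auto
    moreover have "i \<noteq> q"
      using ijk q by auto
    moreover have "1 \<le> j" "j \<le> Suc m" "1 \<le> k" "k \<le> Suc m" "1 \<le> l" "i \<le> Suc m"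
      using ijk by auto
    ultimately have "1 \<le> r i" "r i < r j" "r j < r k" "r k < r l" "r l \<le> m"
      "delete_at q p (r j) < delete_at q p (r k)" "delete_at q p (r k) < delete_at q p (r l)" "delete_at q p (r l) < delete_at q p (r i)"
      using r r_less ijk lt by (metis+)
    then show False
      using av unfolding avoiding_def by blast
  qed
  show "avoiding (Suc m) p"
    unfolding avoiding_def using 1 2 by blast
qed

text \<open>Inversions avoiding position \<open>q\<close> survive the deletion. The maximum at
  \<open>q\<close> forms an inversion with each of the \<open>Suc m - q\<close> letters to its right
  and with none to its left.\<close>

lemma inv_count_delete_at:
  assumes q: "1 \<le> q" "q \<le> Suc m"
    and max: "\<And>j. 1 \<le> j \<Longrightarrow> j \<le> Suc m \<Longrightarrow> j \<noteq> q \<Longrightarrow> p j < p q"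
  shows "inv_count (Suc m) p = inv_count m (delete_at q p) + (Suc m - q)"
proof -
  define s where "s j = (if j < q then j else Suc j)" for j
  let ?I = "\<lambda>n p. {(i :: nat, j). i \<in> {1..n} \<and> j \<in> {1..n} \<and> i < j \<and> p i > (p j :: nat)}"
  have del: "delete_at q p j = p (s j)" for j by (simp add: delete_at_def s_def)
  have s_less: "s i < s j \<longleftrightarrow> i < j" for i j by (auto simp: s_def)
  have inj: "inj s"
    by (metis injI nat_neq_iff s_less)
  have s_range: "j \<in> s ` {1..m}" if "1 \<le> j" "j \<le> Suc m" "j \<noteq> q" for j
    using that q by (intro image_eqI[of _ _ "if j < q then j else j - 1"]) (auto simp: s_def)
  have fin: "finite (?I n p)" for n p
    by (rule finite_subset[of _ "{1..n} \<times> {1..n}"]) auto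
  have "?I (Suc m) p = map_prod s s ` ?I m (delete_at q p) \<union> Pair q ` {Suc q..Suc m}"
  proof (intro equalityI subsetI)
    fix z assume "z \<in> ?I (Suc m) p"
    then obtain i j where z: "z = (i, j)" "1 \<le> i" "i < j" "j \<le> Suc m" "p j < p i" by auto
    then have "j \<noteq> q" using max[of i] by auto
    show "z \<in> map_prod s s ` ?I m (delete_at q p) \<union> Pair q ` {Suc q..Suc m}"
    proof (cases "i = q")
      case False
      obtain i' j' where "i = s i'" "j = s j'" "i' \<in> {1..m}" "j' \<in> {1..m}"
        using s_range[of i] s_range[of j] False \<open>j \<noteq> q\<close> z by auto
      then have "z = map_prod s s (i', j')" "(i', j') \<in> ?I m (delete_at q p)"
        using z s_less by (auto simp: del)
      then show ?thesis by blast
    qed (use z in auto)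
  next
    fix z assume "z \<in> map_prod s s ` ?I m (delete_at q p) \<union> Pair q ` {Suc q..Suc m}"
    then consider i j where "z = (s i, s j)" "i \<in> {1..m}" "j \<in> {1..m}" "i < j" "p (s j) < p (s i)"
      | j where "z = (q, j)" "q < j" "j \<le> Suc m"
      unfolding del by auto
    then show "z \<in> ?I (Suc m) p"
    proof cases
      case 1
      moreover have "s l \<in> {1..Suc m}" if "l \<in> {1..m}" for l
        using that by (auto simp: s_def)
      ultimately show ?thesis
        using s_less by simp
    next
      case 2
      then show ?thesis
        using max[of j] q by simp
    qed
  qed
  moreover have "map_prod s s ` ?I m (delete_at q p) \<inter> Pair q ` {Suc q..Suc m} = {}"
  proof -
    have "s l \<noteq> q" for l by (simp add: s_def)
    then show ?thesis by fastforce
  qed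
  moreover have "card (map_prod s s ` ?I m (delete_at q p)) = card (?I m (delete_at q p))"
    by (rule card_image) (rule inj_on_subset[OF prod.inj_map[OF inj inj]], simp)
  moreover have "card (Pair q ` {Suc q..Suc m}) = Suc m - q"
    by (simp add: card_image inj_on_def)
  moreover have "finite (map_prod s s ` ?I m (delete_at q p))" "finite (Pair q ` {Suc q..Suc m})"
    by (intro finite_imageI fin finite_atLeastAtMost)+
  ultimately show ?thesis
    unfolding inv_count_def by (simp only: card_Un_disjoint)
qed

section \<open>Statistics under multiplication by a transposition\<close>

lemma permutes_Suc: "p permutes {1..n} \<Longrightarrow> p permutes {1..Suc n}"
  by (erule permutes_subset) simp

text \<open>Permutations fix everything outside their range, so those of [n] literally are those of
  [n+1] that fix n+1; no embedding has to be carried along.\<close>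

lemma permutes_Suc_iff: "p permutes {1..n} \<longleftrightarrow> p permutes {1..Suc n} \<and> p (Suc n) = Suc n"
proof
  assume "p permutes {1..n}"
  then show "p permutes {1..Suc n} \<and> p (Suc n) = Suc n"
    using permutes_Suc permutes_not_in[of p "{1..n}" "Suc n"] by simp
next
  assume p: "p permutes {1..Suc n} \<and> p (Suc n) = Suc n"
  then show "p permutes {1..n}"
    by (intro permutes_superset[OF conjunct1[OF p]]) (auto simp: atLeastAtMostSuc_conv)
qed

lemma permutes_comp_transpose:
  assumes "p permutes {1..m}" "1 \<le> i" "i \<le> m"
  shows "p \<circ> transpose i (Suc m) permutes {1..Suc m}"
proof (rule permutes_compose)
  show "transpose i (Suc m) permutes {1..Suc m}"
    using assms(2,3) by (intro permutes_swap_id) simp_all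
qed (rule permutes_Suc[OF assms(1)])

lemma permutes_comp_transpose_max:
  assumes p: "p permutes {1..Suc m}" and i: "p i = Suc m"
  shows "p \<circ> transpose i (Suc m) permutes {1..m}"
proof -
  have "i \<in> {1..Suc m}"
    using permutes_in_image[OF p, of i] i by simp
  then have "transpose i (Suc m) permutes {1..Suc m}"
    by (intro permutes_swap_id) simp_all
  then have "p \<circ> transpose i (Suc m) permutes {1..Suc m}"
    by (rule permutes_compose[OF _ p])
  moreover have "(p \<circ> transpose i (Suc m)) (Suc m) = Suc m"
    using i by simp
  ultimately show ?thesis
    using permutes_Suc_iff by blast
qed

text \<open>The new permutation sends \<open>i\<close> to \<open>Suc m\<close> and
  \<open>Suc m\<close> to \<open>p i\<close>, so \<open>Suc m\<close> is spliced into the cycle of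
  \<open>i\<close> and the other cycles stay as they are.\<close>

lemma orbit_comp_transpose:
  assumes p: "p permutes {1..m}" and i: "1 \<le> i" "i \<le> m" and j: "1 \<le> j" "j \<le> m"
  shows "orbit (p \<circ> transpose i (Suc m)) j - {Suc m} = orbit p j"
proof -
  define p' where "p' = p \<circ> transpose i (Suc m)"
  have perm: "permutation p"
    using p by (meson finite_atLeastAtMost permutation_permutes)
  have p': "p' i = Suc m" "p' (Suc m) = p i" "\<And>l. l \<noteq> i \<Longrightarrow> l \<noteq> Suc m \<Longrightarrow> p' l = p l"
    using permutes_not_in[OF p, of "Suc m"] by (auto simp: p'_def)
  have range: "p l \<in> {1..m}" if "l \<in> {1..m}" for l
    using permutes_in_image[OF p, of l] that by blast
  \<comment> \<open>A step of \<open>p\<close> is one step of \<open>p'\<close>, or two when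
    \<open>l = i\<close>, by the detour through \<open>Suc m\<close>.\<close>
  have pstep: "p l \<in> orbit p' j" if "l \<in> {1..m}" "p' l \<in> orbit p' j" for l
  proof (cases "l = i")
    case True
    then have "Suc m \<in> orbit p' j"
      using that p'(1) by simp
    from orbit.step[OF this] show ?thesis
      using True p'(2) by simp
  next
    case False
    then have "p' l = p l"
      using that(1) p'(3)[of l] by simp
    then show ?thesis
      using that(2) by simp
  qed
  have sub: "y \<in> {1..m} \<and> y \<in> orbit p' j" if "y \<in> orbit p j" for y
    using that
  proof induction
    case base
    have "j \<in> {1..m}" using j by simp
    then show ?case
      using range[of j] pstep[of j] orbit.base[of p' j] by blast
  next
    case (step y)
    then have y: "y \<in> {1..m}" "y \<in> orbit p' j" by simp_all
    from y(1) range[OF y(1)] pstep[OF y(1) orbit.step[OF y(2)]] show ?case by blast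
  qed
  have notin: "Suc m \<notin> orbit p j"
    using sub[of "Suc m"] by (meson atLeastAtMost_iff not_less_eq_eq order_refl)
  \<comment> \<open>\<open>Suc m\<close> can only be entered from \<open>i\<close>; the invariant
    records this so that the next step, to \<open>p i\<close>, stays in the old orbit.\<close>
  have "y \<in> orbit p j \<or> y = Suc m \<and> i \<in> orbit p j" if "y \<in> orbit p' j" for y
    using that
  proof induction
    case base
    show ?case
    proof (cases "j = i")
      case True
      then show ?thesis
        using permutation_self_in_orbit[OF perm, of j] p'(1) by simp
    next
      case False
      then have "p' j = p j"
        using j p'(3)[of j] by simp
      then show ?thesis
        using orbit.base[of p j] by simp
    qed
  next
    case (step y)
    show ?case
    proof (cases "y = Suc m")
      case True
      have "i \<in> orbit p j"
        using step.IH notin True by simp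
      then show ?thesis
        using True p'(2) orbit.step[of i p j] by simp
    next
      case False
      then have "y \<in> orbit p j"
        using step.IH by simp
      from this orbit.step[OF this] show ?thesis
        using False p'(1) p'(3)[of y] by (cases "y = i") simp_all
    qed
  qed
  then show ?thesis
    using sub notin unfolding p'_def by blast
qed

text \<open>Removing \<open>Suc m\<close> from each orbit is a bijection from the new orbits to the
  old ones.\<close>

lemma cyc_comp_transpose:
  assumes p: "p permutes {1..m}" and i: "1 \<le> i" "i \<le> m"
  shows "cyc (Suc m) (p \<circ> transpose i (Suc m)) = cyc m p"
proof -
  define p' where "p' = p \<circ> transpose i (Suc m)"
  let ?D = "\<lambda>X. X - {Suc m}"
  have p'_permutes: "p' permutes {1..Suc m}"
    using permutes_comp_transpose[OF assms] by (simp add: p'_def)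
  then have perm: "permutation p'"
    by (meson finite_atLeastAtMost permutation_permutes)
  have orb: "?D (orbit p' j) = orbit p j" if "j \<in> {1..m}" for j
    using orbit_comp_transpose[OF p i] that by (simp add: p'_def)
  have "p' i = Suc m"
    using permutes_not_in[OF p, of "Suc m"] by (simp add: p'_def)
  then have "orbit p' (Suc m) = orbit p' i"
    using permutation_orbit_step[OF perm, of i] by simp
  \<comment> \<open>\<open>Suc m\<close> shares its orbit with \<open>i\<close>, so it contributes
    no orbit of its own.\<close>
  then have "{orbit p' j |j. j \<in> {1..Suc m}} = orbit p' ` {1..m}"
    using i by (auto simp: le_Suc_eq)
  \<comment> \<open>The orbit of \<open>a\<close> keeps \<open>a\<close> after the removal, and two
    orbits with a common point coincide.\<close>
  moreover have inj: "inj_on ?D (orbit p' ` {1..m})"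
  proof (rule inj_onI, clarify)
    fix a b assume ab: "a \<in> {1..m}" "b \<in> {1..m}" "?D (orbit p' a) = ?D (orbit p' b)"
    have "a \<in> orbit p' b"
    proof -
      have "a \<in> ?D (orbit p' a)"
        using ab(1) permutation_self_in_orbit[OF perm, of a] by simp
      then show ?thesis
        unfolding ab(3) by simp
    qed
    then show "orbit p' a = orbit p' b"
      by (rule orbit_cyclic_eq3[OF cyclic_on_orbit[OF p'_permutes finite_atLeastAtMost]])
  qed
  moreover have "?D ` orbit p' ` {1..m} = {orbit p j |j. j \<in> {1..m}}"
    unfolding image_image setcompr_eq_image using orb by (intro image_cong) auto
  ultimately show ?thesis
    using card_image[OF inj] unfolding cyc_def p'_def[symmetric] by simp
qed

lemma cyc_Suc_fixed:
  assumes p: "p permutes {1..m}"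
  shows "cyc (Suc m) p = Suc (cyc m p)"
proof -
  have orbit_Suc: "orbit p (Suc m) = {Suc m}"
    using permutes_not_in[OF p, of "Suc m"] by (simp add: orbit_eq_singleton_iff)
  have "orbit p j \<noteq> {Suc m}" if "j \<in> {1..m}" for j
    using that orbit.base[of p j] permutes_in_image[OF p, of j] by force
  then have "{Suc m} \<notin> {orbit p j |j. j \<in> {1..m}}"
    by auto
  moreover have "{orbit p j |j. j \<in> {1..Suc m}} = insert {Suc m} {orbit p j |j. j \<in> {1..m}}"
    using orbit_Suc by (auto simp: le_Suc_eq)
  moreover have "finite {orbit p j |j. j \<in> {1..m}}"
    by (simp add: setcompr_eq_image)
  ultimately show ?thesis
    unfolding cyc_def using card_insert_disjoint by simp
qed

lemma comp_transpose_max_simps: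
  assumes p: "p permutes {1..m}" and i: "1 \<le> i" "i \<le> m"
  shows "(p \<circ> transpose i (Suc m)) i = Suc m" "(p \<circ> transpose i (Suc m)) (Suc m) = p i"
    "j \<noteq> i \<Longrightarrow> j \<noteq> Suc m \<Longrightarrow> (p \<circ> transpose i (Suc m)) j = p j"
proof -
  have "p (Suc m) = Suc m"
    using p permutes_Suc_iff by blast
  then show "(p \<circ> transpose i (Suc m)) i = Suc m" "(p \<circ> transpose i (Suc m)) (Suc m) = p i"
    "j \<noteq> i \<Longrightarrow> j \<noteq> Suc m \<Longrightarrow> (p \<circ> transpose i (Suc m)) j = p j"
    by (simp_all add: transpose_def)
qed

lemma permutes_le:
  assumes p: "p permutes {1..m}" and i: "1 \<le> i" "i \<le> m"
  shows "p i \<le> m"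
proof -
  have "p i \<in> {1..m}"
    using permutes_in_image[OF p, of i] i by simp
  then show ?thesis
    by simp
qed

text \<open>Position \<open>i\<close> now carries the maximum and is an excedance, which is new
  unless it was one before; position \<open>Suc m\<close> receives \<open>p i \<le> m\<close> and is
  none.\<close>

lemma exc_comp_transpose:
  assumes p: "p permutes {1..m}" and i: "1 \<le> i" "i \<le> m"
  shows "exc (Suc m) (p \<circ> transpose i (Suc m)) = exc m p + (if i < p i then 0 else 1)"
proof -
  define p' where "p' = p \<circ> transpose i (Suc m)"
  note simps = comp_transpose_max_simps[OF assms, folded p'_def]
  have iff: "p' j > j \<longleftrightarrow> j = i \<or> j \<noteq> Suc m \<and> p j > j" for j
  proof -
    consider "j = i" | "j = Suc m" "j \<noteq> i" | "j \<noteq> i" "j \<noteq> Suc m"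
      by blast
    then show ?thesis
    proof cases
      case 1
      then show ?thesis using simps(1) i by simp
    next
      case 2
      then show ?thesis using simps(2) permutes_le[OF assms] by simp
    next
      case 3
      then show ?thesis using simps(3)[of j] by simp
    qed
  qed
  have "{j \<in> {1..Suc m}. p' j > j} = insert i {j \<in> {1..m}. p j > j}"
    unfolding iff using i by auto
  then show ?thesis
    using i unfolding p'_def by (simp add: exc_def card_insert_if)
qed

lemma exc_Suc_fixed:
  assumes "p permutes {1..m}"
  shows "exc (Suc m) p = exc m p"
proof -
  have "p (Suc m) = Suc m"
    using assms permutes_Suc_iff by blast
  then have "{j \<in> {1..Suc m}. p j > j} = {j \<in> {1..m}. p j > j}"
    by (auto simp: atLeastAtMostSuc_conv)
  then show ?thesis
    by (simp add: exc_def)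
qed

text \<open>The set is kept rather than its size \<open>fp\<close>, since insertion into a cycle
  destroys one particular fixed point.\<close>

definition fixed_points :: "nat \<Rightarrow> (nat \<Rightarrow> nat) \<Rightarrow> nat set" where
  "fixed_points n p = {i \<in> {1..n}. p i = i}"

lemma fixed_points_comp_transpose:
  assumes p: "p permutes {1..m}" and i: "1 \<le> i" "i \<le> m"
  shows "fixed_points (Suc m) (p \<circ> transpose i (Suc m)) = fixed_points m p - {i}"
proof -
  define p' where "p' = p \<circ> transpose i (Suc m)"
  note simps = comp_transpose_max_simps[OF assms, folded p'_def]
  have iff: "p' j = j \<longleftrightarrow> j \<noteq> i \<and> j \<noteq> Suc m \<and> p j = j" for j
  proof -
    consider "j = i" | "j = Suc m" | "j \<noteq> i" "j \<noteq> Suc m"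
      by blast
    then show ?thesis
    proof cases
      case 1
      then show ?thesis using simps(1) i by simp
    next
      case 2
      then show ?thesis using simps(2) permutes_le[OF assms] by simp
    next
      case 3
      then show ?thesis using simps(3)[of j] by simp
    qed
  qed
  show ?thesis
    unfolding fixed_points_def p'_def[symmetric] iff using i by auto
qed

lemma fixed_points_Suc_fixed:
  assumes "p permutes {1..m}"
  shows "fixed_points (Suc m) p = insert (Suc m) (fixed_points m p)"
proof -
  have "p (Suc m) = Suc m"
    using assms permutes_Suc_iff by blast
  then show ?thesis
    by (auto simp: fixed_points_def atLeastAtMostSuc_conv)
qed

lemma finite_fixed_points [simp]: "finite (fixed_points m p)"
  by (simp add: fixed_points_def)

section \<open>Inserting a new maximum\<close>

lemma avoiding_cong: "(\<And>j. 1 \<le> j \<Longrightarrow> j \<le> n \<Longrightarrow> p j = q j) \<Longrightarrow> avoiding n p \<longleftrightarrow> avoiding n q"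
proof -
  have "avoiding n q" if "avoiding n p" and eq: "\<And>j. 1 \<le> j \<Longrightarrow> j \<le> n \<Longrightarrow> p j = q j" for p q
    unfolding avoiding_def
  proof (intro conjI notI; elim exE conjE)
    fix i j k assume *: "1 \<le> i" "i < j" "j < k" "k \<le> n" "q k < q j" "q j < q i"
    then have "p k < p j" "p j < p i"
      using eq[of i] eq[of j] eq[of k] by simp_all
    with * \<open>avoiding n p\<close> show False
      unfolding avoiding_def by blast
  next
    fix i j k l assume *: "1 \<le> i" "i < j" "j < k" "k < l" "l \<le> n" "q j < q k" "q k < q l" "q l < q i"
    then have "p j < p k" "p k < p l" "p l < p i"
      using eq[of i] eq[of j] eq[of k] eq[of l] by simp_all
    with * \<open>avoiding n p\<close> show False
      unfolding avoiding_def by blast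
  qed
  from this[of p q] this[of q p]
  show "(\<And>j. 1 \<le> j \<Longrightarrow> j \<le> n \<Longrightarrow> p j = q j) \<Longrightarrow> avoiding n p \<longleftrightarrow> avoiding n q"
    by metis
qed

lemma inv_count_cong:
  assumes "\<And>j. 1 \<le> j \<Longrightarrow> j \<le> n \<Longrightarrow> p j = q j"
  shows "inv_count n p = inv_count n q"
proof -
  have "{(i, j). i \<in> {1..n} \<and> j \<in> {1..n} \<and> i < j \<and> p i > p j} =
      {(i, j). i \<in> {1..n} \<and> j \<in> {1..n} \<and> i < j \<and> q i > q j}"
    by (rule Collect_cong) (auto simp: assms)
  then show ?thesis
    by (simp add: inv_count_def)
qed

text \<open>The deletion results with \<open>r\<close> as any function that agrees with the
  shortened word on \<open>{1..m}\<close>, so that a genuine permutation can take the place of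
  \<open>delete_at q p\<close>.\<close>

lemma insert_max:
  assumes q: "1 \<le> q" "q \<le> Suc m" "m \<le> Suc q"
    and max: "\<And>j. 1 \<le> j \<Longrightarrow> j \<le> Suc m \<Longrightarrow> j \<noteq> q \<Longrightarrow> p j < p q"
    and asc: "m = Suc q \<Longrightarrow> p (Suc q) < p (Suc (Suc q))"
    and r: "\<And>j. 1 \<le> j \<Longrightarrow> j < q \<Longrightarrow> r j = p j" "\<And>j. q \<le> j \<Longrightarrow> j \<le> m \<Longrightarrow> r j = p (Suc j)"
  shows "avoiding (Suc m) p \<longleftrightarrow> avoiding m r" "inv_count (Suc m) p = inv_count m r + (Suc m - q)"
proof -
  have del: "delete_at q p j = r j" if "1 \<le> j" "j \<le> m" for j
    using r[of j] that by (simp add: delete_at_def)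
  show "avoiding (Suc m) p \<longleftrightarrow> avoiding m r"
    using avoiding_delete_at_iff[OF q max asc] avoiding_cong[of m "delete_at q p" r, OF del] by simp
  show "inv_count (Suc m) p = inv_count m r + (Suc m - q)"
    using inv_count_delete_at[where q = q and p = p, OF q(1,2) max] inv_count_cong[of m "delete_at q p" r, OF del] by simp
qed

lemma Suc_fixed:
  assumes p: "p permutes {1..m}"
  shows "avoiding (Suc m) p \<longleftrightarrow> avoiding m p" "inv_count (Suc m) p = inv_count m p"
proof -
  have top: "p (Suc m) = Suc m"
    using p permutes_Suc_iff by blast
  have max: "p j < p (Suc m)" if "1 \<le> j" "j \<le> Suc m" "j \<noteq> Suc m" for j
    using permutes_le[OF p, of j] that top by simp
  have eq: "p j = p (Suc j)" if "Suc m \<le> j" "j \<le> m" for j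
    using that by simp
  show "avoiding (Suc m) p \<longleftrightarrow> avoiding m p" "inv_count (Suc m) p = inv_count m p"
    using insert_max[of "Suc m" m p p, OF _ _ _ max _ refl eq] by simp_all
qed

text \<open>In one-line notation the last letter \<open>p m\<close> is pushed one place to the right
  and m+1 is put before it; deleting m+1 gives back \<open>p\<close>.\<close>

lemma insert_second:
  assumes p: "p permutes {1..m}" and m: "1 \<le> m"
  defines "p' \<equiv> p \<circ> transpose m (Suc m)"
  shows "avoiding (Suc m) p' \<longleftrightarrow> avoiding m p" "inv_count (Suc m) p' = Suc (inv_count m p)"
proof -
  note p' = comp_transpose_max_simps[OF p m order.refl, folded p'_def]
  have max: "p' j < p' m" if "1 \<le> j" "j \<le> Suc m" "j \<noteq> m" for j
    using permutes_le[OF p, of j] permutes_le[OF p, of m] p'(1,2) p'(3)[of j] that m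
    by (cases "j = Suc m") simp_all
  have eq: "p j = p' j" if "1 \<le> j" "j < m" for j
    using p'(3)[of j] that by simp
  have eq': "p j = p' (Suc j)" if "m \<le> j" "j \<le> m" for j
    using p'(2) that by simp
  show "avoiding (Suc m) p' \<longleftrightarrow> avoiding m p" "inv_count (Suc m) p' = Suc (inv_count m p)"
    using insert_max[of m m p' p, OF m _ _ max _ eq eq'] by simp_all
qed

text \<open>The word of \<open>p'\<close> ends in m+2, \<open>p m\<close>, m+1. Deleting m+2, which
  has two letters to its right, leaves \<open>p\<close> followed by the fixed point m+1.\<close>

lemma insert_third_fixed:
  assumes p: "p permutes {1..m}" and m: "1 \<le> m"
  defines "p' \<equiv> p \<circ> transpose m (Suc m) \<circ> transpose m (Suc (Suc m))"
  shows "avoiding (Suc (Suc m)) p' \<longleftrightarrow> avoiding m p"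
    "inv_count (Suc (Suc m)) p' = Suc (Suc (inv_count m p))"
    "p' m = Suc (Suc m)" "p' (Suc (Suc m)) = Suc m"
proof -
  define p1 where "p1 = p \<circ> transpose m (Suc m)"
  have p1_perm: "p1 permutes {1..Suc m}"
    unfolding p1_def by (rule permutes_comp_transpose[OF p m order.refl])
  note p1 = comp_transpose_max_simps[OF p m order.refl, folded p1_def]
  have "m \<le> Suc m" by simp
  note p' = comp_transpose_max_simps[OF p1_perm m this, folded p1_def p'_def[folded p1_def]]
  have top: "p (Suc m) = Suc m"
    using p permutes_Suc_iff by blast
  show "p' m = Suc (Suc m)" "p' (Suc (Suc m)) = Suc m"
    using p' p1 by simp_all
  have Suc_m: "p' (Suc m) = p m"
    using p1(2) p'(3)[of "Suc m"] by simp
  have below: "p' j = p j" if "j < m" for j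
    using p'(3)[of j] p1(3)[of j] that by simp
  have p_m: "p m \<le> m"
    using permutes_le[OF p m] by simp
  have max: "p' j < p' m" if "1 \<le> j" "j \<le> Suc (Suc m)" "j \<noteq> m" for j
  proof -
    consider "j < m" | "j = Suc m" | "j = Suc (Suc m)" using \<open>j \<le> Suc (Suc m)\<close> \<open>j \<noteq> m\<close> by linarith
    then show ?thesis
    proof cases
      case 1
      then show ?thesis
        using permutes_le[OF p, of j] that below[of j] p'(1) by simp
    qed (use Suc_m p_m p'(1,2) p1 in simp_all)
  qed
  have eq: "p j = p' j" if "1 \<le> j" "j < m" for j
    using below that by simp
  have eq': "p j = p' (Suc j)" if "m \<le> j" "j \<le> Suc m" for j
  proof -
    have "j = m \<or> j = Suc m" using that by auto
    then show ?thesis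
      using Suc_m p'(2) p1(1) top by auto
  qed
  have asc: "p' (Suc m) < p' (Suc (Suc m))"
    using Suc_m p'(2) p1(1) p_m by simp
  show "avoiding (Suc (Suc m)) p' \<longleftrightarrow> avoiding m p"
    "inv_count (Suc (Suc m)) p' = Suc (Suc (inv_count m p))"
    using insert_max[of m "Suc m" p' p, OF m _ _ max asc eq eq'] Suc_fixed[OF p] by simp_all
qed

text \<open>The word of \<open>p'\<close> ends in r+2, r+3, \<open>p r\<close>,
  \<open>p (Suc r)\<close>. Deleting r+3 and then r+2 leaves \<open>p\<close>; each is the maximum
  when deleted and has the final two letters to its right, which ascend by \<open>less\<close>. This
  accounts for the four inversions.\<close>

lemma insert_third_two:
  assumes p: "p permutes {1..Suc r}" and r: "1 \<le> r" and less: "p r < p (Suc r)"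
  defines "p' \<equiv> p \<circ> transpose r (Suc (Suc r)) \<circ> transpose (Suc r) (Suc (Suc (Suc r)))"
  shows "avoiding (Suc (Suc (Suc r))) p' \<longleftrightarrow> avoiding (Suc r) p"
    "inv_count (Suc (Suc (Suc r))) p' = inv_count (Suc r) p + 4"
    "p' r = Suc (Suc r)" "p' (Suc r) = Suc (Suc (Suc r))"
    "p' (Suc (Suc r)) = p r" "p' (Suc (Suc (Suc r))) = p (Suc r)"
proof -
  define p1 where "p1 = p \<circ> transpose r (Suc (Suc r))"
  have p1_perm: "p1 permutes {1..Suc (Suc r)}"
    unfolding p1_def by (rule permutes_comp_transpose[OF p r]) simp
  have "r \<le> Suc r" by simp
  note p1 = comp_transpose_max_simps[OF p r this, folded p1_def]
  have "1 \<le> Suc r" "Suc r \<le> Suc (Suc r)" by simp_all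
  note p' = comp_transpose_max_simps[OF p1_perm this, folded p'_def[folded p1_def]]
  show vals: "p' r = Suc (Suc r)" "p' (Suc r) = Suc (Suc (Suc r))"
    "p' (Suc (Suc r)) = p r" "p' (Suc (Suc (Suc r))) = p (Suc r)"
    using p'(1,2) p'(3)[of r] p'(3)[of "Suc (Suc r)"] p1(1,2) p1(3)[of "Suc r"] by simp_all
  have below: "p' j = p j" if "j < r" for j
    using p'(3)[of j] p1(3)[of j] that by simp
  have p_le: "p j \<le> Suc r" if "1 \<le> j" "j \<le> Suc r" for j
    using permutes_le[OF p that] .
  \<comment> \<open>The intermediate word, with r+3 removed and r+2 still present.\<close>
  define q where "q = delete_at (Suc r) p'"
  have q: "q r = Suc (Suc r)" "q (Suc r) = p r" "q (Suc (Suc r)) = p (Suc r)" "j < r \<Longrightarrow> q j = p j" for j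
    using vals below[of j] by (simp_all add: q_def delete_at_def)
  have max': "p' j < p' (Suc r)" if "1 \<le> j" "j \<le> Suc (Suc (Suc r))" "j \<noteq> Suc r" for j
  proof -
    consider "j < r" | "j = r" | "j = Suc (Suc r)" | "j = Suc (Suc (Suc r))"
      using \<open>j \<le> Suc (Suc (Suc r))\<close> \<open>j \<noteq> Suc r\<close> by linarith
    then show ?thesis
      using below[of j] vals p_le[of j] p_le[of r] p_le[of "Suc r"] r that by cases simp_all
  qed
  have max: "q j < q r" if "1 \<le> j" "j \<le> Suc (Suc r)" "j \<noteq> r" for j
  proof -
    consider "j < r" | "j = Suc r" | "j = Suc (Suc r)"
      using \<open>j \<le> Suc (Suc r)\<close> \<open>j \<noteq> r\<close> by linarith
    then show ?thesis
      using q(1-3) q(4)[of j] p_le[of j] p_le[of r] p_le[of "Suc r"] r that by cases simp_all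
  qed
  have 1: "avoiding (Suc (Suc (Suc r))) p' \<longleftrightarrow> avoiding (Suc (Suc r)) q"
    "inv_count (Suc (Suc (Suc r))) p' = inv_count (Suc (Suc r)) q + 2"
    using insert_max[of "Suc r" "Suc (Suc r)" p' q, OF _ _ _ max'] less vals
    by (simp_all add: q_def delete_at_def)
  have eq: "p j = q j" if "1 \<le> j" "j < r" for j
    using q(4)[of j] that by simp
  have eq': "p j = q (Suc j)" if "r \<le> j" "j \<le> Suc r" for j
  proof -
    have "j = r \<or> j = Suc r" using that by auto
    then show ?thesis
      using q by auto
  qed
  have asc: "q (Suc r) < q (Suc (Suc r))"
    using q less by simp
  have 2: "avoiding (Suc (Suc r)) q \<longleftrightarrow> avoiding (Suc r) p"
    "inv_count (Suc (Suc r)) q = inv_count (Suc r) p + 2"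
    using insert_max[of r "Suc r" q p, OF r _ _ max asc eq eq'] by simp_all
  show "avoiding (Suc (Suc (Suc r))) p' \<longleftrightarrow> avoiding (Suc r) p"
    "inv_count (Suc (Suc (Suc r))) p' = inv_count (Suc r) p + 4"
    using 1 2 by simp_all
qed

section \<open>Where the two largest letters of an avoider can be\<close>

lemma avoiders_321:
  assumes "p \<in> avoiders n" "1 \<le> i" "i < j" "j < k" "k \<le> n" "p j < p i"
  shows "p j < p k"
proof -
  have "\<not> p k < p j"
    using assms unfolding mem_avoiders_iff avoiding_def by blast
  moreover have "p j \<noteq> p k"
    using assms(1,4) permutes_inj[of p] unfolding mem_avoiders_iff by (metis inj_eq less_irrefl)
  ultimately show ?thesis by simp
qed

text \<open>Letters to the right of \<open>p i\<close> and below it increase, as there is no 321.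
  Three of them would therefore complete a 4123, so every letter has at most two smaller letters to
  its right.\<close>

lemma avoiders_4123:
  assumes "p \<in> avoiders n" "1 \<le> i" "i < j" "j < k" "k < l" "l \<le> n" "p j < p i" "p k < p i" "p l < p i"
  shows False
proof -
  have "p j < p k" "p k < p l"
    using assms avoiders_321[of p n i j k] avoiders_321[of p n i k l] by simp_all
  then show False
    using assms unfolding mem_avoiders_iff avoiding_def by blast
qed

lemma avoiders_less_max:
  assumes "p \<in> avoiders n" "p q = n" "1 \<le> j" "j \<le> n" "j \<noteq> q"
  shows "p j < n"
proof -
  have p: "p permutes {1..n}"
    using assms(1) mem_avoiders_iff by blast
  have "p j \<noteq> p q"
    using assms(5) permutes_inj[OF p] by (metis inj_eq)
  then show ?thesis
    using permutes_le[OF p assms(3,4)] assms(2) by simp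
qed

lemma avoiders_max_position:
  assumes p: "p \<in> avoiders n" "p q = n" "1 \<le> q"
  shows "n \<le> Suc (Suc q)"
proof (rule ccontr)
  assume "\<not> n \<le> Suc (Suc q)"
  then show False
    using avoiders_4123[OF p(1,3), of "Suc q" "Suc (Suc q)" "Suc (Suc (Suc q))"]
      avoiders_less_max[OF p(1,2), of "Suc q"] avoiders_less_max[OF p(1,2), of "Suc (Suc q)"]
      avoiders_less_max[OF p(1,2), of "Suc (Suc (Suc q))"] p(2)
    by simp
qed

lemma permutes_max_obtains:
  fixes p :: "nat \<Rightarrow> nat"
  assumes "p permutes {1..n}" "1 \<le> n"
  obtains q where "1 \<le> q" "q \<le> n" "p q = n"
proof -
  have "n \<in> p ` {1..n}"
    using permutes_image[OF assms(1)] assms(2) by simp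
  then obtain q where q: "n = p q" "q \<in> {1..n}"
    by (rule imageE)
  show ?thesis
    by (rule that[OF _ _ q(1)[symmetric]]) (use q(2) in simp_all)
qed

text \<open>Let m+2 be at position \<open>m\<close> and m+1 not at the end. The last two letters
  ascend, so m+1 is not last but one either and lies to the left of m+2. If it were not adjacent to
  m+2, then positions \<open>m - 1\<close>, \<open>Suc m\<close> and \<open>Suc (Suc m)\<close>
  would hold three smaller letters to its right.\<close>

lemma avoiders_second_max_position:
  assumes p: "p \<in> avoiders (Suc (Suc m))" "p m = Suc (Suc m)" "p (Suc (Suc m)) \<noteq> Suc m" and m: "1 \<le> m"
  obtains r where "m = Suc r" "1 \<le> r" "p r = Suc m"
proof -
  have perm: "p permutes {1..Suc (Suc m)}"
    using p(1) mem_avoiders_iff by blast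
  have inj: "p i = p j \<longleftrightarrow> i = j" for i j
    using permutes_inj[OF perm] by (simp add: inj_eq)
  have asc: "p (Suc m) < p (Suc (Suc m))"
    using avoiders_321[OF p(1) m, of "Suc m" "Suc (Suc m)"] avoiders_less_max[OF p(1,2), of "Suc m"] p(2) by simp
  have "Suc m \<in> p ` {1..Suc (Suc m)}"
    using permutes_image[OF perm] by simp
  then obtain k where "Suc m = p k" "k \<in> {1..Suc (Suc m)}"
    by (rule imageE)
  then have k: "1 \<le> k" "k \<le> Suc (Suc m)" "p k = Suc m"
    by simp_all
  have "k \<noteq> m" "k \<noteq> Suc (Suc m)"
    using k(3) p(2,3) by auto
  moreover have "k \<noteq> Suc m"
    using k(3) asc avoiders_less_max[OF p(1,2), of "Suc (Suc m)"] by auto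
  ultimately have "k < m"
    using k by linarith
  moreover have "\<not> k < m - 1"
  proof
    assume km: "k < m - 1"
    have less: "p j < p k" if "1 \<le> j" "j \<le> Suc (Suc m)" "j \<noteq> m" "j \<noteq> k" for j
    proof -
      have "p j < Suc (Suc m)" "p j \<noteq> p k"
        using avoiders_less_max[OF p(1,2)] inj that by blast+
      then show ?thesis
        using k by simp
    qed
    have order: "m - 1 < Suc m" "Suc m < Suc (Suc m)" "Suc (Suc m) \<le> Suc (Suc m)"
      by linarith+
    have "p (m - 1) < p k" "p (Suc m) < p k" "p (Suc (Suc m)) < p k"
      using km k by (intro less; linarith)+
    then show False
      by (rule avoiders_4123[OF p(1) k(1) km order])
  qed
  ultimately have "m = Suc k"
    by linarith
  then show ?thesis
    using that k by blast
qed

section \<open>The recurrences\<close>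

lemma finite_avoiders: "finite (avoiders n)"
  by (rule finite_subset[OF _ finite_permutations[of "{1..n}"]]) (auto simp: mem_avoiders_iff)

lemma comp_transpose_twice [simp]: "p \<circ> transpose i j \<circ> transpose i j = p"
  by (simp add: comp_assoc)

context
  fixes t u x y :: "'a::comm_ring_1"
begin

text \<open>Fixed points in \<open>S\<close> are not counted: they are the ones that are destroyed when a new maximum
  is inserted into their cycle.\<close>

definition wt :: "nat \<Rightarrow> nat set \<Rightarrow> (nat \<Rightarrow> nat) \<Rightarrow> 'a" where
  "wt n S p = t ^ cyc n p * u ^ card (fixed_points n p - S) * x ^ exc n p * y ^ inv_count n p"

text \<open>Length 0 is included: the empty permutation contributes 1, which the recurrences need
  although \<open>Gfun\<close> starts at length 1.\<close>

definition gf :: "nat \<Rightarrow> 'a" where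
  "gf n = (\<Sum>p\<in>avoiders n. wt n {} p)"

text \<open>The weight of a permutation into whose last position a new maximum is about to be
  inserted: a fixed point \<open>n\<close> would be lost, so it carries no \<open>u\<close>.\<close>

definition gf_last :: "nat \<Rightarrow> 'a" where
  "gf_last n = (\<Sum>p\<in>avoiders n. wt n {n} p)"

text \<open>The index is shifted by two, the length of these permutations being \<open>m + 2\<close>; position \<open>0\<close>
  does not exist, so \<open>gf_third 0 = 0\<close>.\<close>

definition gf_third :: "nat \<Rightarrow> 'a" where
  "gf_third m = (\<Sum>p\<in>{p \<in> avoiders (Suc (Suc m)). p m = Suc (Suc m)}. wt (Suc (Suc m)) {} p)"

section \<open>Effect of the insertions on the weight\<close>

lemma wt_Suc_fixed:
  assumes p: "p permutes {1..m}"
  shows "wt (Suc m) {} p = t * u * wt m {} p" "wt (Suc m) {Suc m} p = t * wt m {} p"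
    "wt (Suc m) {m, Suc m} p = t * wt m {m} p"
proof -
  have "Suc m \<notin> fixed_points m p"
    by (simp add: fixed_points_def)
  then have "fixed_points (Suc m) p - {Suc m} = fixed_points m p"
    "fixed_points (Suc m) p - {m, Suc m} = fixed_points m p - {m}"
    "card (fixed_points (Suc m) p) = Suc (card (fixed_points m p))"
    unfolding fixed_points_Suc_fixed[OF p] by auto
  then show "wt (Suc m) {} p = t * u * wt m {} p" "wt (Suc m) {Suc m} p = t * wt m {} p"
    "wt (Suc m) {m, Suc m} p = t * wt m {m} p"
    unfolding wt_def cyc_Suc_fixed[OF p] exc_Suc_fixed[OF p] Suc_fixed(2)[OF p]
    by (simp_all add: mult_ac)
qed

text \<open>As \<open>p m \<le> m\<close>, position \<open>m\<close> becomes a new excedance, and it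
  stops being a fixed point if it was one; exactly one inversion is added.\<close>

lemma wt_second:
  assumes p: "p permutes {1..m}" and m: "1 \<le> m"
  shows "wt (Suc m) {} (p \<circ> transpose m (Suc m)) = x * y * wt m {m} p"
  unfolding wt_def cyc_comp_transpose[OF p m order.refl] exc_comp_transpose[OF p m order.refl]
    fixed_points_comp_transpose[OF p m order.refl] insert_second(2)[OF p m]
  using permutes_le[OF p m order.refl] by (simp add: mult_ac)

text \<open>Only one factor \<open>x\<close> arises: the first transposition already makes
  \<open>m\<close> an excedance, and the second merely raises its value.\<close>

lemma wt_third_fixed:
  assumes p: "p permutes {1..m}" and m: "1 \<le> m"
  shows "wt (Suc (Suc m)) {} (p \<circ> transpose m (Suc m) \<circ> transpose m (Suc (Suc m))) =
    x * y ^ 2 * wt m {m} p"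
proof -
  have p1: "p \<circ> transpose m (Suc m) permutes {1..Suc m}"
    by (rule permutes_comp_transpose[OF p m order.refl])
  have m': "m \<le> Suc m" by simp
  have "(p \<circ> transpose m (Suc m)) m = Suc m"
    by (rule comp_transpose_max_simps[OF p m order.refl])
  then show ?thesis
    unfolding wt_def cyc_comp_transpose[OF p1 m m'] exc_comp_transpose[OF p1 m m']
      fixed_points_comp_transpose[OF p1 m m'] insert_third_fixed(2)[OF p m]
      cyc_comp_transpose[OF p m order.refl] exc_comp_transpose[OF p m order.refl]
      fixed_points_comp_transpose[OF p m order.refl]
    using permutes_le[OF p m order.refl] by (simp add: mult_ac power2_eq_square)
qed

text \<open>From \<open>p r < p (Suc r)\<close> and \<open>p (Suc r) \<le> Suc r\<close> neither
  \<open>r\<close> nor \<open>Suc r\<close> is an excedance of \<open>p\<close>, so both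
  transpositions create one, and both positions lose a possible fixed point.\<close>

lemma wt_third_two:
  assumes p: "p permutes {1..Suc r}" and r: "1 \<le> r" and less: "p r < p (Suc r)"
  shows "wt (Suc (Suc (Suc r))) {}
      (p \<circ> transpose r (Suc (Suc r)) \<circ> transpose (Suc r) (Suc (Suc (Suc r)))) =
    x ^ 2 * y ^ 4 * wt (Suc r) {r, Suc r} p"
proof -
  have r': "r \<le> Suc r" by simp
  have p1: "p \<circ> transpose r (Suc (Suc r)) permutes {1..Suc (Suc r)}"
    by (rule permutes_comp_transpose[OF p r r'])
  have m: "1 \<le> Suc r" "Suc r \<le> Suc (Suc r)" by simp_all
  have "(p \<circ> transpose r (Suc (Suc r))) (Suc r) = p (Suc r)"
    by (rule comp_transpose_max_simps[OF p r r']) simp_all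
  moreover have "p (Suc r) \<le> Suc r"
    using permutes_le[OF p] by simp
  moreover have "fixed_points (Suc r) p - {r} - {Suc r} = fixed_points (Suc r) p - {r, Suc r}"
    by auto
  ultimately show ?thesis
    unfolding wt_def cyc_comp_transpose[OF p1 m] exc_comp_transpose[OF p1 m]
      fixed_points_comp_transpose[OF p1 m] insert_third_two(2)[OF p r less]
      cyc_comp_transpose[OF p r r'] exc_comp_transpose[OF p r r']
      fixed_points_comp_transpose[OF p r r']
    using less by (simp add: mult_ac power_add power2_eq_square)
qed

section \<open>Bijections according to the position of the maximum\<close>

lemma avoiders_fixed_eq: "{p \<in> avoiders (Suc m). p (Suc m) = Suc m} = avoiders m"
proof (rule set_eqI)
  fix p
  show "p \<in> {p \<in> avoiders (Suc m). p (Suc m) = Suc m} \<longleftrightarrow> p \<in> avoiders m"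
    unfolding mem_Collect_eq mem_avoiders_iff using permutes_Suc_iff[of p m] Suc_fixed(1)[of p m] by blast
qed

lemma sum_second:
  fixes f :: "(nat \<Rightarrow> nat) \<Rightarrow> 'a"
  assumes m: "1 \<le> m"
  shows "(\<Sum>p\<in>{p \<in> avoiders (Suc m). p m = Suc m}. f p) = (\<Sum>p\<in>avoiders m. f (p \<circ> transpose m (Suc m)))"
proof (rule sum.reindex_bij_witness[of _ "\<lambda>p. p \<circ> transpose m (Suc m)" "\<lambda>p. p \<circ> transpose m (Suc m)"])
  fix p assume "p \<in> {p \<in> avoiders (Suc m). p m = Suc m}"
  then have p: "p permutes {1..Suc m}" "avoiding (Suc m) p" "p m = Suc m"
    unfolding mem_avoiders_iff by blast+
  have "p \<circ> transpose m (Suc m) permutes {1..m}"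
    by (rule permutes_comp_transpose_max[OF p(1,3)])
  then show "p \<circ> transpose m (Suc m) \<in> avoiders m"
    using insert_second(1)[of "p \<circ> transpose m (Suc m)" m] m p(2) unfolding mem_avoiders_iff by simp
next
  fix p assume "p \<in> avoiders m"
  then have p: "p permutes {1..m}" "avoiding m p"
    unfolding mem_avoiders_iff by blast+
  show "p \<circ> transpose m (Suc m) \<in> {p \<in> avoiders (Suc m). p m = Suc m}"
    using permutes_comp_transpose[OF p(1) m order.refl] insert_second(1)[OF p(1) m] p(2)
      comp_transpose_max_simps(1)[OF p(1) m order.refl] unfolding mem_avoiders_iff by blast
qed simp_all

lemma gf_0: "gf 0 = 1"
proof -
  have "avoiders 0 = {id}"
    by (auto simp: mem_avoiders_iff avoiding_def)
  moreover have "wt 0 {} id = 1"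
    by (simp add: wt_def cyc_def exc_def inv_count_def fixed_points_def)
  ultimately show ?thesis
    by (simp add: gf_def)
qed

lemma sum_avoiders_split:
  fixes f :: "(nat \<Rightarrow> nat) \<Rightarrow> 'a"
  shows "(\<Sum>p\<in>avoiders (Suc m). f p) = (\<Sum>p\<in>avoiders m. f p) + (\<Sum>p\<in>{p \<in> avoiders (Suc m). p (Suc m) \<noteq> Suc m}. f p)"
proof -
  have "avoiders (Suc m) = avoiders m \<union> {p \<in> avoiders (Suc m). p (Suc m) \<noteq> Suc m}"
    using avoiders_fixed_eq[of m] by blast
  moreover have "avoiders m \<inter> {p \<in> avoiders (Suc m). p (Suc m) \<noteq> Suc m} = {}"
    using avoiders_fixed_eq[of m] by blast
  ultimately show ?thesis
    using finite_avoiders sum.union_disjoint[of "avoiders m" "{p \<in> avoiders (Suc m). p (Suc m) \<noteq> Suc m}" f] by simp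
qed

lemma sum_wt_fixed:
  "(\<Sum>p\<in>avoiders m. wt (Suc m) {} p) = t * u * gf m" "(\<Sum>p\<in>avoiders m. wt (Suc m) {Suc m} p) = t * gf m"
  "(\<Sum>p\<in>avoiders m. wt (Suc m) {m, Suc m} p) = t * gf_last m"
proof -
  have perm: "p permutes {1..m}" if "p \<in> avoiders m" for p
    using that mem_avoiders_iff by blast
  show "(\<Sum>p\<in>avoiders m. wt (Suc m) {} p) = t * u * gf m"
    unfolding gf_def sum_distrib_left by (intro sum.cong refl wt_Suc_fixed perm)
  show "(\<Sum>p\<in>avoiders m. wt (Suc m) {Suc m} p) = t * gf m"
    unfolding gf_def sum_distrib_left by (intro sum.cong refl wt_Suc_fixed perm)
  show "(\<Sum>p\<in>avoiders m. wt (Suc m) {m, Suc m} p) = t * gf_last m"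
    unfolding gf_last_def sum_distrib_left by (intro sum.cong refl wt_Suc_fixed perm)
qed

text \<open>The two weights differ only on permutations fixing \<open>Suc m\<close>, which are the
  avoiders of length \<open>m\<close>; there the factor is \<open>t\<close> instead of
  \<open>t * u\<close>.\<close>

lemma gf_last_Suc: "gf_last (Suc m) = gf (Suc m) + t * (1 - u) * gf m"
proof -
  have "(\<Sum>p\<in>{p \<in> avoiders (Suc m). p (Suc m) \<noteq> Suc m}. wt (Suc m) {Suc m} p) =
      (\<Sum>p\<in>{p \<in> avoiders (Suc m). p (Suc m) \<noteq> Suc m}. wt (Suc m) {} p)"
    by (rule sum.cong) (auto simp: wt_def fixed_points_def intro!: arg_cong[of _ _ card])
  then show ?thesis
    unfolding gf_last_def gf_def[of "Suc m"] sum_avoiders_split sum_wt_fixed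
    by (simp add: algebra_simps)
qed

lemma gf_1: "gf 1 = t * u"
proof -
  have "p \<in> avoiders 1 \<Longrightarrow> p 1 = 1" for p
    using permutes_in_image[of p "{1..1}" 1] unfolding mem_avoiders_iff by simp
  then have "{p \<in> avoiders (Suc 0). p (Suc 0) \<noteq> Suc 0} = {}"
    by auto
  then show ?thesis
    unfolding One_nat_def gf_def[of "Suc 0"] sum_avoiders_split[of _ 0] sum_wt_fixed gf_0
    by (simp only: sum.empty mult_1_right add_0_right)
qed

text \<open>The three summands belong to the maximum being last, last but one and last but
  two.\<close>

lemma gf_Suc_Suc: "gf (Suc (Suc m)) = t * u * gf (Suc m) + x * y * gf_last (Suc m) + gf_third m"
proof -
  let ?n = "Suc (Suc m)"
  let ?B = "{p \<in> avoiders ?n. p (Suc m) = ?n}" and ?C = "{p \<in> avoiders ?n. p m = ?n}"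
  have "p (Suc m) = ?n \<or> p m = ?n" if p: "p \<in> avoiders ?n" "p ?n \<noteq> ?n" for p
  proof -
    have "p permutes {1..?n}"
      using p mem_avoiders_iff by blast
    then obtain q where q: "1 \<le> q" "q \<le> ?n" "p q = ?n"
      by (rule permutes_max_obtains) simp
    then have "q = m \<or> q = Suc m"
      using avoiders_max_position[OF p(1) q(3,1)] p(2) by (metis Suc_le_mono le_Suc_eq le_antisym)
    then show ?thesis
      using q by auto
  qed
  moreover have "\<not> (p ?n = ?n \<and> p (Suc m) = ?n)" "\<not> (p ?n = ?n \<and> p m = ?n)"
    "\<not> (p (Suc m) = ?n \<and> p m = ?n)" if p: "p \<in> avoiders ?n" for p
  proof -
    have "inj p"
      using p mem_avoiders_iff permutes_inj by blast
    then show "\<not> (p ?n = ?n \<and> p (Suc m) = ?n)" "\<not> (p ?n = ?n \<and> p m = ?n)"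
        "\<not> (p (Suc m) = ?n \<and> p m = ?n)"
      by (metis injD n_not_Suc_n Suc_n_not_le_n le_SucI order.refl)+
  qed
  ultimately have "{p \<in> avoiders ?n. p ?n \<noteq> ?n} = ?B \<union> ?C" "?B \<inter> ?C = {}"
    by blast+
  moreover have "finite ?B" "finite ?C"
    using finite_avoiders by simp_all
  ultimately have "(\<Sum>p\<in>{p \<in> avoiders ?n. p ?n \<noteq> ?n}. wt ?n {} p) =
      (\<Sum>p\<in>?B. wt ?n {} p) + (\<Sum>p\<in>?C. wt ?n {} p)"
    by (simp add: sum.union_disjoint)
  moreover have "(\<Sum>p\<in>?B. wt ?n {} p) = x * y * gf_last (Suc m)"
  proof -
    have "(\<Sum>p\<in>?B. wt ?n {} p) = (\<Sum>p\<in>avoiders (Suc m). wt ?n {} (p \<circ> transpose (Suc m) ?n))"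
      by (rule sum_second) simp
    also have "\<dots> = (\<Sum>p\<in>avoiders (Suc m). x * y * wt (Suc m) {Suc m} p)"
    proof (rule sum.cong[OF refl])
      fix p assume "p \<in> avoiders (Suc m)"
      then have "p permutes {1..Suc m}"
        using mem_avoiders_iff by blast
      then show "wt ?n {} (p \<circ> transpose (Suc m) ?n) = x * y * wt (Suc m) {Suc m} p"
        by (rule wt_second) simp
    qed
    finally show ?thesis
      by (simp add: gf_last_def sum_distrib_left)
  qed
  ultimately show ?thesis
    unfolding gf_def[of ?n] sum_avoiders_split[of _ "Suc m"] sum_wt_fixed gf_third_def
    by (simp add: add_ac)
qed

lemma gf_third_0: "gf_third 0 = 0"
proof -
  have "p 0 = 0" if "p \<in> avoiders (Suc (Suc 0))" for p
    using that permutes_not_in[of p "{1..Suc (Suc 0)}" 0] mem_avoiders_iff by fastforce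
  then have "{p \<in> avoiders (Suc (Suc 0)). p 0 = Suc (Suc 0)} = {}"
    by fastforce
  then show ?thesis
    unfolding gf_third_def by (simp only: sum.empty)
qed

text \<open>The insertion is undone by the same two transpositions in reverse order. These are the
  words ending in m+2, a letter, m+1.\<close>

lemma sum_third_fixed:
  fixes f :: "(nat \<Rightarrow> nat) \<Rightarrow> 'a"
  assumes m: "1 \<le> m"
  shows "(\<Sum>p\<in>{p \<in> avoiders (Suc (Suc m)). p m = Suc (Suc m) \<and> p (Suc (Suc m)) = Suc m}. f p) =
    (\<Sum>p\<in>avoiders m. f (p \<circ> transpose m (Suc m) \<circ> transpose m (Suc (Suc m))))"
proof (rule sum.reindex_bij_witness[of _
      "\<lambda>p. p \<circ> transpose m (Suc m) \<circ> transpose m (Suc (Suc m))"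
      "\<lambda>p. p \<circ> transpose m (Suc (Suc m)) \<circ> transpose m (Suc m)"])
  fix p assume "p \<in> {p \<in> avoiders (Suc (Suc m)). p m = Suc (Suc m) \<and> p (Suc (Suc m)) = Suc m}"
  then have p: "p permutes {1..Suc (Suc m)}" "avoiding (Suc (Suc m)) p" "p m = Suc (Suc m)"
      "p (Suc (Suc m)) = Suc m"
    unfolding mem_avoiders_iff by blast+
  have p1: "p \<circ> transpose m (Suc (Suc m)) permutes {1..Suc m}"
    by (rule permutes_comp_transpose_max[OF p(1,3)])
  have "(p \<circ> transpose m (Suc (Suc m))) m = Suc m"
    using p(4) by simp
  then have "p \<circ> transpose m (Suc (Suc m)) \<circ> transpose m (Suc m) permutes {1..m}"
    by (rule permutes_comp_transpose_max[OF p1])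
  then show "p \<circ> transpose m (Suc (Suc m)) \<circ> transpose m (Suc m) \<in> avoiders m"
    using insert_third_fixed(1)[of "p \<circ> transpose m (Suc (Suc m)) \<circ> transpose m (Suc m)" m] m p(2)
    unfolding mem_avoiders_iff comp_transpose_twice by blast
next
  fix p assume "p \<in> avoiders m"
  then have p: "p permutes {1..m}" "avoiding m p"
    unfolding mem_avoiders_iff by blast+
  have "m \<le> Suc m" by simp
  then have "p \<circ> transpose m (Suc m) \<circ> transpose m (Suc (Suc m)) permutes {1..Suc (Suc m)}"
    by (intro permutes_comp_transpose[OF permutes_comp_transpose[OF p(1) m order.refl] m])
  then show "p \<circ> transpose m (Suc m) \<circ> transpose m (Suc (Suc m)) \<in>
      {p \<in> avoiders (Suc (Suc m)). p m = Suc (Suc m) \<and> p (Suc (Suc m)) = Suc m}"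
    using insert_third_fixed(1,3,4)[OF p(1) m] p(2) unfolding mem_avoiders_iff by blast
qed (simp_all only: comp_transpose_twice)

text \<open>Here m+1 stands directly before m+2. Removing both leaves the two letters after the
  maximum as the new final letters; they ascend, whence the condition \<open>p r < p m\<close> on
  the right.\<close>

lemma sum_third_two:
  fixes f :: "(nat \<Rightarrow> nat) \<Rightarrow> 'a"
  assumes r: "1 \<le> r"
  defines "m \<equiv> Suc r"
  shows "(\<Sum>p\<in>{p \<in> avoiders (Suc (Suc m)). p m = Suc (Suc m) \<and> p (Suc (Suc m)) \<noteq> Suc m}. f p) =
    (\<Sum>p\<in>{p \<in> avoiders m. p r < p m}. f (p \<circ> transpose r (Suc m) \<circ> transpose m (Suc (Suc m))))"
proof (rule sum.reindex_bij_witness[of _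
      "\<lambda>p. p \<circ> transpose r (Suc m) \<circ> transpose m (Suc (Suc m))"
      "\<lambda>p. p \<circ> transpose m (Suc (Suc m)) \<circ> transpose r (Suc m)"])
  have m: "1 \<le> m" by (simp add: m_def)
  fix p assume "p \<in> {p \<in> avoiders (Suc (Suc m)). p m = Suc (Suc m) \<and> p (Suc (Suc m)) \<noteq> Suc m}"
  then have p: "p \<in> avoiders (Suc (Suc m))" "p m = Suc (Suc m)" "p (Suc (Suc m)) \<noteq> Suc m"
    by blast+
  have perm: "p permutes {1..Suc (Suc m)}" and av: "avoiding (Suc (Suc m)) p"
    using p(1) mem_avoiders_iff by blast+
  have p_r: "p r = Suc m"
    using avoiders_second_max_position[OF p m] by (metis m_def nat.inject)
  have p1: "p \<circ> transpose m (Suc (Suc m)) permutes {1..Suc m}"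
    by (rule permutes_comp_transpose_max[OF perm p(2)])
  have "(p \<circ> transpose m (Suc (Suc m))) r = Suc m"
    using p_r by (simp add: m_def)
  then have p2: "p \<circ> transpose m (Suc (Suc m)) \<circ> transpose r (Suc m) permutes {1..m}"
    by (rule permutes_comp_transpose_max[OF p1])
  have vals: "(p \<circ> transpose m (Suc (Suc m)) \<circ> transpose r (Suc m)) r = p (Suc m)"
    "(p \<circ> transpose m (Suc (Suc m)) \<circ> transpose r (Suc m)) m = p (Suc (Suc m))"
    by (simp_all add: m_def transpose_def)
  have "p (Suc m) < p (Suc (Suc m))"
    using avoiders_321[OF p(1) m, of "Suc m" "Suc (Suc m)"] avoiders_less_max[OF p(1,2), of "Suc m"] p(2) by simp
  then show "p \<circ> transpose m (Suc (Suc m)) \<circ> transpose r (Suc m) \<in> {p \<in> avoiders m. p r < p m}"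
    using insert_third_two(1)[of "p \<circ> transpose m (Suc (Suc m)) \<circ> transpose r (Suc m)" r,
        folded m_def, OF p2 r] av p2 vals
    unfolding mem_avoiders_iff comp_transpose_twice by simp
next
  fix p assume "p \<in> {p \<in> avoiders m. p r < p m}"
  then have p: "p permutes {1..m}" "avoiding m p" "p r < p m"
    unfolding mem_avoiders_iff by blast+
  note ins = insert_third_two[of p r, folded m_def, OF p(1) r p(3)]
  have "r \<le> m" "1 \<le> m" "m \<le> Suc m" by (simp_all add: m_def)
  then have "p \<circ> transpose r (Suc m) \<circ> transpose m (Suc (Suc m)) permutes {1..Suc (Suc m)}"
    by (intro permutes_comp_transpose[OF permutes_comp_transpose[OF p(1) r]])
  moreover have "p m \<noteq> Suc m"
    using permutes_le[OF p(1) \<open>1 \<le> m\<close>] by simp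
  ultimately show "p \<circ> transpose r (Suc m) \<circ> transpose m (Suc (Suc m)) \<in>
      {p \<in> avoiders (Suc (Suc m)). p m = Suc (Suc m) \<and> p (Suc (Suc m)) \<noteq> Suc m}"
    using ins(1,4,6) p(2) unfolding mem_avoiders_iff by simp
qed (simp_all only: comp_transpose_twice)

text \<open>A word ends in an ascent exactly when its maximum is not last but one. If the maximum is
  last, it is a fixed point with weight \<open>t\<close>, and its predecessor may still be one to be
  omitted; if it is last but two, there is nothing to omit.\<close>

lemma sum_ascent:
  "(\<Sum>p\<in>{p \<in> avoiders (Suc (Suc s)). p (Suc s) < p (Suc (Suc s))}. wt (Suc (Suc s)) {Suc s, Suc (Suc s)} p) =
     t * gf_last (Suc s) + gf_third s"
proof -
  let ?n = "Suc (Suc s)"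
  let ?C = "{p \<in> avoiders ?n. p s = ?n}"
  have asc: "p (Suc s) < p ?n \<longleftrightarrow> p ?n = ?n \<or> p s = ?n" if p: "p \<in> avoiders ?n" for p
  proof
    assume less: "p (Suc s) < p ?n"
    have perm: "p permutes {1..?n}"
      using p mem_avoiders_iff by blast
    then obtain q where q: "1 \<le> q" "q \<le> ?n" "p q = ?n"
      by (rule permutes_max_obtains) simp
    moreover have "q \<noteq> Suc s"
      using less q permutes_le[OF perm, of ?n] by auto
    ultimately have "q = s \<or> q = ?n"
      using avoiders_max_position[OF p q(3,1)] by linarith
    then show "p ?n = ?n \<or> p s = ?n"
      using q by auto
  next
    assume "p ?n = ?n \<or> p s = ?n"
    then show "p (Suc s) < p ?n"
    proof
      assume "p ?n = ?n"
      then show ?thesis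
        using avoiders_less_max[OF p, of ?n "Suc s"] by simp
    next
      assume s: "p s = ?n"
      \<comment> \<open>Position 0 lies outside the permuted range and is mapped to itself, so it
        cannot carry the maximum.\<close>
      have "s \<noteq> 0"
      proof
        assume "s = 0"
        then show False
          using s p permutes_not_in[of p "{1..?n}" 0] mem_avoiders_iff by fastforce
      qed
      then show ?thesis
        using avoiders_321[OF p, of s "Suc s" ?n] avoiders_less_max[OF p s, of "Suc s"] s by simp
    qed
  qed
  have disj: "\<not> (p ?n = ?n \<and> p s = ?n)" if "p \<in> avoiders ?n" for p
    using that mem_avoiders_iff permutes_inj by (metis injD n_not_Suc_n Suc_n_not_le_n le_SucI order.refl)
  have "{p \<in> avoiders ?n. p (Suc s) < p ?n} = avoiders (Suc s) \<union> ?C" "avoiders (Suc s) \<inter> ?C = {}"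
    unfolding avoiders_fixed_eq[of "Suc s", symmetric] using asc disj by blast+
  then have "(\<Sum>p\<in>{p \<in> avoiders ?n. p (Suc s) < p ?n}. wt ?n {Suc s, ?n} p) =
      (\<Sum>p\<in>avoiders (Suc s). wt ?n {Suc s, ?n} p) + (\<Sum>p\<in>?C. wt ?n {Suc s, ?n} p)"
    using finite_avoiders by (simp add: sum.union_disjoint)
  also have "(\<Sum>p\<in>?C. wt ?n {Suc s, ?n} p) = (\<Sum>p\<in>?C. wt ?n {} p)"
  proof (rule sum.cong[OF refl])
    fix p assume "p \<in> ?C"
    then have p: "p \<in> avoiders ?n" "p s = ?n"
      by blast+
    have less: "p (Suc s) < p ?n"
      using asc p by blast
    \<comment> \<open>With the ascent this gives \<open>p (Suc s) \<le> s\<close>, so neither of the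
      last two positions is fixed.\<close>
    have "p ?n < ?n"
      using avoiders_less_max[OF p] by simp
    then have "fixed_points ?n p - {Suc s, ?n} = fixed_points ?n p"
      using less by (auto simp: fixed_points_def)
    then show "wt ?n {Suc s, ?n} p = wt ?n {} p"
      by (simp add: wt_def)
  qed
  finally show ?thesis
    unfolding sum_wt_fixed gf_third_def .
qed

text \<open>The cases are whether m+1 is the final letter. The sum over the remaining permutations
  is left as it is, because it vanishes for \<open>m = 1\<close> and is evaluated by
  \<open>sum_third_two\<close> only from \<open>m = 2\<close> on.\<close>

lemma gf_third_split:
  assumes m: "1 \<le> m"
  shows "gf_third m = x * y ^ 2 * gf_last m +
    (\<Sum>p\<in>{p \<in> avoiders (Suc (Suc m)). p m = Suc (Suc m) \<and> p (Suc (Suc m)) \<noteq> Suc m}. wt (Suc (Suc m)) {} p)"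
    (is "_ = _ + sum _ ?D")
proof -
  let ?n = "Suc (Suc m)"
  let ?C = "{p \<in> avoiders ?n. p m = ?n \<and> p ?n = Suc m}"
  have "{p \<in> avoiders ?n. p m = ?n} = ?C \<union> ?D" "?C \<inter> ?D = {}"
    by blast+
  then have "gf_third m = (\<Sum>p\<in>?C. wt ?n {} p) + (\<Sum>p\<in>?D. wt ?n {} p)"
    using finite_avoiders unfolding gf_third_def by (simp add: sum.union_disjoint)
  also have "(\<Sum>p\<in>?C. wt ?n {} p) =
      (\<Sum>p\<in>avoiders m. wt ?n {} (p \<circ> transpose m (Suc m) \<circ> transpose m (Suc (Suc m))))"
    by (rule sum_third_fixed[OF m])
  also have "\<dots> = (\<Sum>p\<in>avoiders m. x * y ^ 2 * wt m {m} p)"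
    using mem_avoiders_iff by (intro sum.cong refl wt_third_fixed[OF _ m]) blast
  finally show ?thesis
    by (simp add: gf_last_def sum_distrib_left)
qed

text \<open>The second sum is empty: the second largest letter would have to sit at position
  0.\<close>

lemma gf_third_1: "gf_third 1 = x * y ^ 2 * gf_last 1"
proof -
  have "{p \<in> avoiders (Suc (Suc 1)). p 1 = Suc (Suc 1) \<and> p (Suc (Suc 1)) \<noteq> Suc 1} = {}"
  proof -
    have False if "p \<in> avoiders (Suc (Suc 1))" "p 1 = Suc (Suc 1)" "p (Suc (Suc 1)) \<noteq> Suc 1" for p
      by (rule avoiders_second_max_position[OF that]) simp_all
    then show ?thesis by blast
  qed
  then show ?thesis
    unfolding gf_third_split[OF order.refl] by (simp only: sum.empty add_0_right)
qed

lemma gf_third_Suc_Suc: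
  "gf_third (Suc (Suc s)) =
    x * y ^ 2 * gf_last (Suc (Suc s)) + x ^ 2 * y ^ 4 * (t * gf_last (Suc s) + gf_third s)"
proof -
  let ?m = "Suc (Suc s)" and ?r = "Suc s"
  have "(\<Sum>p\<in>{p \<in> avoiders (Suc (Suc ?m)). p ?m = Suc (Suc ?m) \<and> p (Suc (Suc ?m)) \<noteq> Suc ?m}.
        wt (Suc (Suc ?m)) {} p) =
      (\<Sum>p\<in>{p \<in> avoiders ?m. p ?r < p ?m}.
        wt (Suc (Suc ?m)) {} (p \<circ> transpose ?r (Suc ?m) \<circ> transpose ?m (Suc (Suc ?m))))"
    by (rule sum_third_two) simp
  also have "\<dots> = (\<Sum>p\<in>{p \<in> avoiders ?m. p ?r < p ?m}. x ^ 2 * y ^ 4 * wt ?m {?r, ?m} p)"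
  proof (rule sum.cong[OF refl])
    fix p assume "p \<in> {p \<in> avoiders ?m. p ?r < p ?m}"
    then have "p permutes {1..?m}" "p ?r < p ?m"
      using mem_avoiders_iff by blast+
    then show "wt (Suc (Suc ?m)) {} (p \<circ> transpose ?r (Suc ?m) \<circ> transpose ?m (Suc (Suc ?m))) =
        x ^ 2 * y ^ 4 * wt ?m {?r, ?m} p"
      by (intro wt_third_two) simp_all
  qed
  also have "\<dots> = x ^ 2 * y ^ 4 * (t * gf_last ?r + gf_third s)"
    by (simp only: sum_ascent flip: sum_distrib_left)
  finally show ?thesis
    using gf_third_split[of ?m] by simp
qed

end

section \<open>The generating function\<close>

text \<open>\<open>H\<close> and \<open>T\<close> stand for the series of \<open>gf_last\<close> and
  \<open>gf_third\<close>, and the hypotheses are their recurrences. \<open>T\<close> is read off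
  from the first one and \<open>H\<close> from the second; inserting both into the third gives a
  linear equation for \<open>G\<close>, without any division.\<close>

lemma gf_rational:
  fixes G H T t u x y z :: "'a::comm_ring_1"
  assumes G: "G = t * u * z * (1 + G) + x * y * z * H + T"
    and H: "H = G + t * (1 - u) * z * (1 + G)"
    and T: "T = z ^ 2 * (x * y ^ 2 * H + x ^ 2 * y ^ 4 * (t * z * H + T))"
  shows "G * (1 - z * (x * y + t * u) + z ^ 2 * \<gg>\<^sub>2 t u x y + z ^ 3 * \<gg>\<^sub>3 t u x y + z ^ 4 * \<gg>\<^sub>4 t u x y) =
    t * z * (u + x * y * z * (1 - u) + x * y ^ 2 * z ^ 2 * (1 - u * x * y ^ 2 - u)
                + x ^ 2 * y ^ 4 * z ^ 3 * (x * y - t) * (u - 1))"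
proof -
  have T': "T = G - t * u * z * (1 + G) - x * y * z * H"
    using G by (simp add: algebra_simps)
  have "(1 - x ^ 2 * y ^ 4 * z ^ 2) * T = x * y ^ 2 * z ^ 2 * H * (1 + x * y ^ 2 * t * z)"
    using T by (simp add: algebra_simps power2_eq_square power4_eq_xxxx)
  then have "(1 - x ^ 2 * y ^ 4 * z ^ 2) *
      (G - t * u * z * (1 + G) - x * y * z * (G + t * (1 - u) * z * (1 + G))) =
      x * y ^ 2 * z ^ 2 * (G + t * (1 - u) * z * (1 + G)) * (1 + x * y ^ 2 * t * z)"
    unfolding T' H .
  \<comment> \<open>The difference of the two sides is the claimed denominator times
    \<open>G\<close> minus the claimed numerator, as an identity of polynomials.\<close>
  moreover have "(1 - x ^ 2 * y ^ 4 * z ^ 2) *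
      (G - t * u * z * (1 + G) - x * y * z * (G + t * (1 - u) * z * (1 + G))) -
      x * y ^ 2 * z ^ 2 * (G + t * (1 - u) * z * (1 + G)) * (1 + x * y ^ 2 * t * z) =
    G * (1 - z * (x * y + t * u) + z ^ 2 * \<gg>\<^sub>2 t u x y + z ^ 3 * \<gg>\<^sub>3 t u x y + z ^ 4 * \<gg>\<^sub>4 t u x y) -
    t * z * (u + x * y * z * (1 - u) + x * y ^ 2 * z ^ 2 * (1 - u * x * y ^ 2 - u)
                + x ^ 2 * y ^ 4 * z ^ 3 * (x * y - t) * (u - 1))"
    unfolding \<gg>\<^sub>2_def \<gg>\<^sub>3_def \<gg>\<^sub>4_def
    by (simp add: algebra_simps power2_eq_square power3_eq_cube power4_eq_xxxx)
  ultimately show ?thesis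
    by simp
qed

text \<open>The sum over exponent tuples is regrouped as a sum over avoiders, each tuple collecting
  the fibre of the four statistics; only the finitely many attained tuples contribute.\<close>

lemma Gfun_nth:
  assumes "1 \<le> n"
  shows "fps_nth Gfun n = gf var_t var_u var_x var_y n"
proof -
  let ?f = "\<lambda>p. (cyc n p, exc n p, fp n p, inv_count n p)"
  let ?w = "\<lambda>(k, l, m, j). var_t ^ k * var_u ^ m * var_x ^ l * var_y ^ j"
  have fiber: "gnum n (fst v) (fst (snd v)) (fst (snd (snd v))) (snd (snd (snd v))) =
      card {p \<in> avoiders n. ?f p = v}" for v
    by (simp add: gnum_def avoiders_def prod_eq_iff)
  have wt: "?w (?f p) = wt var_t var_u var_x var_y n {} p" for p
    by (simp add: wt_def fp_def fixed_points_def)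
  have "fps_nth Gfun n = Sum_any (\<lambda>v. of_nat (card {p \<in> avoiders n. ?f p = v}) * ?w v)"
    using assms by (simp add: Gfun_def case_prod_unfold mult.assoc fiber)
  also have "\<dots> = (\<Sum>v\<in>?f ` avoiders n. of_nat (card {p \<in> avoiders n. ?f p = v}) * ?w v)"
  proof (rule Sum_any.expand_superset)
    show "{v. of_nat (card {p \<in> avoiders n. ?f p = v}) * ?w v \<noteq> 0} \<subseteq> ?f ` avoiders n"
    proof
      fix v assume "v \<in> {v. of_nat (card {p \<in> avoiders n. ?f p = v}) * ?w v \<noteq> 0}"
      then have "{p \<in> avoiders n. ?f p = v} \<noteq> {}"
        by (metis (mono_tags, lifting) card.empty mem_Collect_eq mult_zero_left of_nat_0)
      then show "v \<in> ?f ` avoiders n"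
        by blast
    qed
  qed (simp add: finite_avoiders)
  also have "\<dots> = (\<Sum>v\<in>?f ` avoiders n. \<Sum>p\<in>{p \<in> avoiders n. ?f p = v}. ?w (?f p))"
    by (rule sum.cong) auto
  also have "\<dots> = (\<Sum>p\<in>avoiders n. ?w (?f p))"
    by (rule sum.image_gen[OF finite_avoiders, symmetric])
  finally show ?thesis
    unfolding wt gf_def .
qed

theorem theorem20:
  fixes t u x y z :: "poly4 fps"
  defines "t \<equiv> fps_const var_t"
    and "u \<equiv> fps_const var_u"
    and "x \<equiv> fps_const var_x"
    and "y \<equiv> fps_const var_y"
    and "z \<equiv> fps_X"
  shows "Gfun = fps_quot
    (t * z * (u + x * y * z * (1 - u) + x * y ^ 2 * z ^ 2 * (1 - u * x * y ^ 2 - u)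
                + x ^ 2 * y ^ 4 * z ^ 3 * (x * y - t) * (u - 1)))
    (1 - z * (x * y + t * u) + z ^ 2 * \<gg>\<^sub>2 t u x y + z ^ 3 * \<gg>\<^sub>3 t u x y + z ^ 4 * \<gg>\<^sub>4 t u x y)"
proof -
  let ?gf = "gf var_t var_u var_x var_y"
  let ?last = "gf_last var_t var_u var_x var_y"
  let ?third = "gf_third var_t var_u var_x var_y"
  \<comment> \<open>\<open>gf_last\<close> is cut off at 0 because \<open>Gfun\<close> has no
    constant term; the factor \<open>fps_X ^ 2\<close> in \<open>T\<close> makes up for the index
    shift in \<open>gf_third\<close>.\<close>
  define H where "H = Abs_fps (\<lambda>n. if n = 0 then 0 else ?last n)"
  define T where "T = fps_X ^ 2 * Abs_fps ?third"
  have G_nth: "fps_nth Gfun n = (if n = 0 then 0 else ?gf n)" for n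
    by (cases n) (simp_all add: Gfun_nth, simp add: Gfun_def)
  have T_nth: "fps_nth T 0 = 0" "fps_nth T (Suc 0) = 0" "fps_nth T (Suc (Suc n)) = ?third n" for n
    by (simp_all add: T_def fps_X_power_mult_nth)
  \<comment> \<open>In these equations \<open>1 + Gfun\<close> restores the empty
    permutation.\<close>
  have eq_G: "Gfun = t * u * z * (1 + Gfun) + x * y * z * H + T"
  proof (rule fps_ext)
    fix n
    consider "n = 0" | "n = Suc 0" | m where "n = Suc (Suc m)"
      by (metis not0_implies_Suc)
    then show "fps_nth Gfun n = fps_nth (t * u * z * (1 + Gfun) + x * y * z * H + T) n"
      by cases (simp_all add: t_def u_def x_def y_def z_def mult.assoc G_nth H_def T_nth
          gf_1[unfolded One_nat_def] gf_Suc_Suc)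
  qed
  have eq_H: "H = Gfun + t * (1 - u) * z * (1 + Gfun)"
  proof (rule fps_ext)
    fix n
    have const: "t * (1 - u) = fps_const (var_t * (1 - var_u))"
      by (simp add: t_def u_def flip: fps_const_1_eq_1)
    consider "n = 0" | "n = Suc 0" | m where "n = Suc (Suc m)"
      by (metis not0_implies_Suc)
    then show "fps_nth H n = fps_nth (Gfun + t * (1 - u) * z * (1 + Gfun)) n"
      unfolding const
      by cases (simp_all add: z_def mult.assoc G_nth H_def gf_last_Suc gf_0)
  qed
  have eq_T: "T = z ^ 2 * (x * y ^ 2 * H + x ^ 2 * y ^ 4 * (t * z * H + T))"
  proof (rule fps_ext)
    fix n
    have const: "x * y ^ 2 = fps_const (var_x * var_y ^ 2)"
      "x ^ 2 * y ^ 4 = fps_const (var_x ^ 2 * var_y ^ 4)"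
      by (simp_all add: x_def y_def fps_const_power)
    \<comment> \<open>Coefficients 2 and 3 are the initial values \<open>gf_third 0\<close> and
      \<open>gf_third 1\<close>; from 4 on the recurrence applies.\<close>
    consider "n = 0" | "n = 1" | "n = 2" | "n = 3" | m where "n = Suc (Suc (Suc (Suc m)))"
      by (metis One_nat_def not0_implies_Suc numeral_2_eq_2 numeral_3_eq_3)
    then show "fps_nth T n = fps_nth (z ^ 2 * (x * y ^ 2 * H + x ^ 2 * y ^ 4 * (t * z * H + T))) n"
      unfolding const
      by cases (simp_all add: z_def t_def mult.assoc fps_X_power_mult_nth H_def T_nth
          numeral_2_eq_2 numeral_3_eq_3 gf_third_0 gf_third_1[unfolded One_nat_def] gf_third_Suc_Suc)
  qed
  have "fps_nth (1 - z * (x * y + t * u) + z ^ 2 * \<gg>\<^sub>2 t u x y + z ^ 3 * \<gg>\<^sub>3 t u x y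
      + z ^ 4 * \<gg>\<^sub>4 t u x y) 0 = 1"
    by (simp add: z_def)
  then show ?thesis
    using gf_rational[OF eq_G eq_H eq_T] fps_quot_iff by blast
qed

end
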